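(* Let $X\neq\{0\}$ be a real linear space and let $Y$ be a Banach lattice. Then $Y$ is weakly sequentially complete if and only if for every closed convex normal cone $K\subset Y$ and every $K$-convex function $f:X\to Y$, the directional derivative $f'(x_0;h)$ exists for all $x_0\in X$ and all $h\in X\setminus\{0\}$.
   Context: A nonempty subset $K$ of a real normed space $Y$ is a cone if $\lambda K \subset K$ for every $\lambda \ge 0$ and $K+K\subset K$. Write $x \le_K y$ if $y-x\in K$. A cone $K$ is normal if there is $C>0$ such that $0\le_K x\le_K y$ implies $\|x\|\le C\|y\|$. (The cones $K$ are arbitrary and need not be related to the lattice order of $Y$.) A function $f:X\to Y$ is $K$-convex if $\lambda f(x)+(1-\lambda)f(y)-f(\lambda x+(1-\lambda)y)\in K$ for all $x,y\in X$ and all $\lambda\in[0,1]$. The directional derivative of $f$ at $x_0\in X$ in the direction $h\neq 0$ is $f'(x_0;h)=\lim_{t\downarrow 0}\frac{f(x_0+th)-f(x_0)}{t}$, the limit being taken in the norm of $Y$; it is said to exist if this limit exists in $Y$. $Y$ is weakly sequentially complete if every weakly Cauchy sequence in $Y$ converges weakly to an element of $Y$. *)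

theory Defs
  imports "HOL-Analysis.Analysis" "HOL-Library.Lattice_Algebras"
begin

text \<open>Real Banach lattices. The modulus is the lattice one,
  \<open>\<bar>x\<bar> = sup x (- x)\<close>, by the class \<open>lattice_ab_group_add_abs\<close>.\<close>

class banach_lattice = banach + ordered_real_vector + lattice_ab_group_add_abs +
  assumes norm_mono_abs: "\<bar>x\<bar> \<le> \<bar>y\<bar> \<Longrightarrow> norm x \<le> norm y"

instance real :: banach_lattice
  by standard (auto simp: sup_real_def)

text \<open>The library predicate \<open>cone\<close> only asks for closure under nonnegative
  multiples. The cones used here are also nonempty and closed under addition.\<close>

definition ordering_cone :: "'b::real_vector set \<Rightarrow> bool" where
  "ordering_cone K \<longleftrightarrow> K \<noteq> {} \<and> cone K \<and> (\<forall>x\<in>K. \<forall>y\<in>K. x + y \<in> K)"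

lemma ordering_cone_iff_convex_cone: "ordering_cone K \<longleftrightarrow> convex_cone K"
proof -
  have "0 \<in> K" if "K \<noteq> {}" "cone K"
    using that by (rule cone_contains_0[THEN iffD1, rotated])
  then show ?thesis
    unfolding ordering_cone_def convex_cone_iff cone_def by blast
qed

definition cone_le :: "'b::real_vector set \<Rightarrow> 'b \<Rightarrow> 'b \<Rightarrow> bool" where
  "cone_le K x y \<longleftrightarrow> y - x \<in> K"

definition normal_cone :: "'b::real_normed_vector set \<Rightarrow> bool" where
  "normal_cone K \<longleftrightarrow> ordering_cone K \<and>
     (\<exists>C>0. \<forall>x y. cone_le K 0 x \<and> cone_le K x y \<longrightarrow> norm x \<le> C * norm y)"

definition cone_convex :: "'b::real_vector set \<Rightarrow> ('a::real_vector \<Rightarrow> 'b) \<Rightarrow> bool" where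
  "cone_convex K f \<longleftrightarrow> (\<forall>x y. \<forall>t\<in>{0..1}.
     t *\<^sub>R f x + (1 - t) *\<^sub>R f y - f (t *\<^sub>R x + (1 - t) *\<^sub>R y) \<in> K)"

definition has_dir_deriv ::
    "('a::real_vector \<Rightarrow> 'b::real_normed_vector) \<Rightarrow> 'a \<Rightarrow> 'a \<Rightarrow> 'b \<Rightarrow> bool" where
  "has_dir_deriv f x\<^sub>0 h D \<longleftrightarrow>
     ((\<lambda>t. (f (x\<^sub>0 + t *\<^sub>R h) - f x\<^sub>0) /\<^sub>R t) \<longlongrightarrow> D) (at_right 0)"

text \<open>A sequence is Cauchy for the uniformity of the weak topology iff its image under
  every continuous linear functional is Cauchy. The continuous linear functionals on \<open>'b\<close>
  are the bounded linear maps \<open>'b \<Rightarrow> real\<close>.\<close>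

definition weakly_Cauchy :: "(nat \<Rightarrow> 'b::real_normed_vector) \<Rightarrow> bool" where
  "weakly_Cauchy u \<longleftrightarrow> (\<forall>\<phi>::'b \<Rightarrow> real. bounded_linear \<phi> \<longrightarrow> Cauchy (\<lambda>n. \<phi> (u n)))"

definition weakly_converges_to :: "(nat \<Rightarrow> 'b::real_normed_vector) \<Rightarrow> 'b \<Rightarrow> bool" where
  "weakly_converges_to u y \<longleftrightarrow>
     (\<forall>\<phi>::'b \<Rightarrow> real. bounded_linear \<phi> \<longrightarrow> (\<lambda>n. \<phi> (u n)) \<longlonglongrightarrow> \<phi> y)"

definition weakly_sequentially_complete :: "'b::real_normed_vector itself \<Rightarrow> bool" where
  "weakly_sequentially_complete _ \<longleftrightarrow>
     (\<forall>u::nat \<Rightarrow> 'b. weakly_Cauchy u \<longrightarrow> (\<exists>y. weakly_converges_to u y))"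

end

theory Submission
  imports Defs
begin

text \<open>Forward direction: the difference quotients of \<open>f\<close> decrease for \<open>K\<close> and are bounded
  below, and by Krein's theorem every functional is a difference of \<open>K\<close>-positive ones, so they
  are weakly Cauchy. By Mazur's theorem the weak limit is approximated in norm by upper bounds
  of the small quotients, and normality of \<open>K\<close> then forces norm convergence.

  Backward direction: for a positive functional \<open>\<alpha>\<close> the cone \<open>{y. norm (pprt (- y)) \<le> \<alpha> y}\<close> is
  normal, and an increasing norm-bounded sequence of \<open>Y\<close> is order bounded for it. Encoding the
  sequence in the slopes of a convex function at \<open>0\<close> shows that it converges, that is, \<open>Y\<close> is a
  KB-space. In a KB-space let \<open>F\<close> be the weak limit, as a functional on the dual, of a weakly
  Cauchy sequence \<open>u\<close>. A Vitali--Hahn--Saks argument makes \<open>F\<close> order continuous. Let \<open>G\<close> be the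
  supremum of the elements of \<open>Y\<close> below \<open>F\<^sup>+\<close>. If \<open>F\<^sup>+ \<noteq> G\<close>, then a Hahn decomposition
  and a carrier argument produce a further element \<open>x > 0\<close> of \<open>Y\<close> below \<open>F\<^sup>+ - G\<close>. So \<open>F\<^sup>+\<close>, and
  likewise \<open>F\<^sup>-\<close>, is represented in \<open>Y\<close>.\<close>

section \<open>The Hahn--Banach theorem in Mazur--Orlicz form\<close>

text \<open>A norm-bounded increasing sequence need not be order bounded in the lattice order, so
  the lattice cone alone gives no vector above all its terms. In the enlarged cone a negative part
  is allowed as far as \<open>\<alpha>\<close> pays for it, and a positive vector with a large value
  of \<open>\<alpha>\<close> then lies above all partial sums of the increments.

  In the second half no bidual is formed. \<open>F\<close> is a limit evaluated on functionals, its
  positive part is a supremum over \<open>dual_interval\<close>, and statements about bands become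
  estimates on order intervals. The control measure of the classical Vitali--Hahn--Saks theorem
  becomes \<open>\<lambda>\<xi>. \<xi> e\<close> for one positive \<open>e\<close> with
  \<open>\<bar>u n\<bar> \<le> 2 ^ n *\<^sub>R e\<close>; order continuity is used in the form that
  functionals small at \<open>e\<close> are uniformly small along \<open>u\<close>. Separation,
  Krein's theorem, positive parts and cluster points of functionals all come from one extension
  theorem with side constraints; only the cone of constraints and the sublinear bound
  change.\<close>

lemma ordering_cone_zero: "ordering_cone K \<Longrightarrow> 0 \<in> K"
  using cone_contains_0[of K] by (auto simp: ordering_cone_def)

lemma ordering_coneI:
  assumes "z \<in> A" "\<And>x y. x \<in> A \<Longrightarrow> y \<in> A \<Longrightarrow> x + y \<in> A" "\<And>t x. t \<ge> 0 \<Longrightarrow> x \<in> A \<Longrightarrow> t *\<^sub>R x \<in> A"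
  shows "ordering_cone A"
  using assms by (auto simp: ordering_cone_def cone_def)

definition sublinear :: "('a::real_vector \<Rightarrow> real) \<Rightarrow> bool" where
  "sublinear p \<longleftrightarrow> (\<forall>x y. p (x + y) \<le> p x + p y) \<and> (\<forall>t\<ge>0. \<forall>x. p (t *\<^sub>R x) = t * p x)"

lemma sublinearD:
  assumes "sublinear p"
  shows "p (x + y) \<le> p x + p y" "t \<ge> 0 \<Longrightarrow> p (t *\<^sub>R x) = t * p x" "p 0 = 0" "- p (- x) \<le> p x"
proof -
  show "p (x + y) \<le> p x + p y" "t \<ge> 0 \<Longrightarrow> p (t *\<^sub>R x) = t * p x"
    using assms by (auto simp: sublinear_def)
  show p0: "p 0 = 0"
    using assms unfolding sublinear_def by (metis mult_zero_left order_refl scaleR_zero_left)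
  have "p (x + - x) \<le> p x + p (- x)"
    using assms unfolding sublinear_def by blast
  then show "- p (- x) \<le> p x" using p0 by simp
qed

lemma sublinearI:
  assumes add: "\<And>x y. p (x + y) \<le> p x + p y"
    and scale: "\<And>t x. t > 0 \<Longrightarrow> p (t *\<^sub>R x) \<le> t * p x"
    and zero: "p 0 = 0"
  shows "sublinear p"
proof -
  have "p (t *\<^sub>R x) = t * p x" if "t \<ge> 0" for t x
  proof (cases "t = 0")
    case False
    with that have t: "t > 0" by simp
    have "p (inverse t *\<^sub>R t *\<^sub>R x) \<le> inverse t * p (t *\<^sub>R x)"
      using t by (intro scale) auto
    then have "t * p x \<le> p (t *\<^sub>R x)"
      using t by (simp add: field_simps)
    with scale[OF t] show ?thesis by (intro antisym)
  qed (simp add: zero)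
  with add show ?thesis by (simp add: sublinear_def)
qed

text \<open>\<open>q\<close> absorbs the constraints into the bound: a linear
  \<open>f \<le> q\<close> has \<open>f (- a) \<le> p 0 - b\<close>, hence
  \<open>b \<le> f a\<close>. The hypothesis \<open>b \<le> p a\<close> keeps the infimum above
  \<open>- p (- x)\<close>.\<close>

lemma sublinear_shift:
  fixes A :: "('a::real_vector \<times> real) set"
  assumes p: "sublinear p" and A: "ordering_cone A"
    and le: "\<And>a b. (a, b) \<in> A \<Longrightarrow> b \<le> p a"
  defines "q \<equiv> \<lambda>x. INF z\<in>A. p (x + fst z) - snd z"
  shows "sublinear q" "q x \<le> p x" "(a, b) \<in> A \<Longrightarrow> q x \<le> p (x + a) - b"
proof -
  have A0: "(0, 0) \<in> A"
    using ordering_cone_zero[OF A] by (simp add: zero_prod_def)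
  have Aadd: "(a + a', b + b') \<in> A" if "(a, b) \<in> A" "(a', b') \<in> A" for a b a' b'
    using A that unfolding ordering_cone_def by (metis add_Pair)
  have Ascale: "(t *\<^sub>R a, t * b) \<in> A" if "(a, b) \<in> A" "t \<ge> 0" for a b t
    using A that unfolding ordering_cone_def cone_def by (metis real_scaleR_def scaleR_Pair)
  have lower: "- p (- x) \<le> p (x + fst z) - snd z" if "z \<in> A" for x z
  proof -
    have "p ((x + fst z) + - x) \<le> p (x + fst z) + p (- x)"
      by (rule sublinearD(1)[OF p])
    with le[of "fst z" "snd z"] that show ?thesis by simp
  qed
  then have bdd: "bdd_below ((\<lambda>z. p (x + fst z) - snd z) ` A)" for x
    by (intro bdd_belowI2)
  have ne: "A \<noteq> {}" using A0 by auto
  show upper: "q x \<le> p (x + a) - b" if "(a, b) \<in> A" for x a b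
    unfolding q_def using cINF_lower[OF bdd that, of x] by simp
  show "q x \<le> p x" using upper[OF A0] by simp
  have q_ge: "c \<le> q x" if "\<And>a b. (a, b) \<in> A \<Longrightarrow> c \<le> p (x + a) - b" for c x
    unfolding q_def using ne that by (intro cINF_greatest) auto
  show "sublinear q"
  proof (rule sublinearI)
    fix x y
    have "q (x + y) - (p (y + a') - b') \<le> p (x + a) - b"
      if "(a, b) \<in> A" "(a', b') \<in> A" for a b a' b'
      using upper[OF Aadd[OF that], of "x + y"] sublinearD(1)[OF p, of "x + a" "y + a'"]
      by (simp add: algebra_simps)
    then have "q (x + y) - (p (y + a') - b') \<le> q x" if "(a', b') \<in> A" for a' b'
      using that q_ge by blast
    then have "q (x + y) - q x \<le> q y"
      by (intro q_ge) (auto simp: algebra_simps)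
    then show "q (x + y) \<le> q x + q y" by simp
  next
    fix t :: real and x assume t: "t > 0"
    have "q (t *\<^sub>R x) / t \<le> p (x + a) - b" if "(a, b) \<in> A" for a b
      using upper[OF Ascale[OF that], of t "t *\<^sub>R x"] t sublinearD(2)[OF p, of t "x + a"]
      by (simp add: field_simps)
    then have "q (t *\<^sub>R x) / t \<le> q x" by (intro q_ge)
    then show "q (t *\<^sub>R x) \<le> t * q x" using t by (simp add: field_simps)
  next
    have "0 \<le> q 0" using le by (intro q_ge) auto
    with upper[OF A0, of 0] show "q 0 = 0" by (simp add: sublinearD(3)[OF p])
  qed
qed

text \<open>A minimal sublinear functional is linear, because its shift along any direction
  is again sublinear and lies below it.\<close>

lemma minimal_sublinear_imp_linear:
  assumes q: "sublinear q" and min: "\<And>r. sublinear r \<Longrightarrow> r \<le> q \<Longrightarrow> r = q"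
  shows "linear q"
proof -
  have ge: "q x + q y \<le> q (x + y)" for x y
  proof -
    let ?A = "(\<lambda>t. (t *\<^sub>R y, t * q y)) ` {0..}"
    define r where "r = (\<lambda>x. INF z\<in>?A. q (x + fst z) - snd z)"
    have A: "ordering_cone ?A"
    proof (rule ordering_coneI)
      show "(0 *\<^sub>R y, 0 * q y) \<in> ?A" by (intro imageI) simp
    next
      fix u v assume "u \<in> ?A" "v \<in> ?A"
      then obtain s t where "u = (s *\<^sub>R y, s * q y)" "v = (t *\<^sub>R y, t * q y)" "s \<ge> 0" "t \<ge> 0" by auto
      then have "u + v = ((s + t) *\<^sub>R y, (s + t) * q y)" "s + t \<in> {0..}" by (auto simp: algebra_simps)
      then show "u + v \<in> ?A" by blast
    next
      fix c :: real and u assume "c \<ge> 0" "u \<in> ?A"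
      then obtain s where "u = (s *\<^sub>R y, s * q y)" "s \<ge> 0" by auto
      then have "c *\<^sub>R u = ((c * s) *\<^sub>R y, (c * s) * q y)" "c * s \<in> {0..}" using \<open>c \<ge> 0\<close> by auto
      then show "c *\<^sub>R u \<in> ?A" by blast
    qed
    have le: "b \<le> q a" if "(a, b) \<in> ?A" for a b
      using that sublinearD(2)[OF q] by auto
    have "r = q"
    proof (rule min)
      show "sublinear r" unfolding r_def using sublinear_shift(1)[OF q A le] .
      show "r \<le> q" unfolding r_def using sublinear_shift(2)[OF q A le] by (intro le_funI)
    qed
    moreover have "r x \<le> q (x + y) - q y"
      unfolding r_def
    proof (rule sublinear_shift(3)[OF q A le])
      show "(y, q y) \<in> ?A" by (rule image_eqI[of _ _ 1]) auto
    qed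
    ultimately have "q x \<le> q (x + y) - q y" by simp
    then show ?thesis by simp
  qed
  have add: "q (x + y) = q x + q y" for x y
    using ge sublinearD(1)[OF q] by (intro antisym)
  have neg: "q (- x) = - q x" for x
    using add[of x "- x"] sublinearD(3)[OF q] by simp
  have "q (t *\<^sub>R x) = t * q x" for t x
    using sublinearD(2)[OF q, of t x] sublinearD(2)[OF q, of "- t" x] neg[of "t *\<^sub>R x"]
    by (cases "t \<ge> 0") auto
  with add show ?thesis by (intro linearI) auto
qed

text \<open>Zorn's lemma with the order reversed, so that bounds of chains are pointwise infima. All
  members of a chain lie above \<open>- p (- x)\<close>, which keeps the infimum finite, and of two
  members the smaller one serves for both in the proof of subadditivity.\<close>

lemma ex_linear_le_sublinear:
  assumes p: "sublinear p"
  shows "\<exists>f. linear f \<and> (\<forall>x. f x \<le> p x)"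
proof -
  define S where "S = {q. sublinear q \<and> q \<le> p}"
  let ?P = "\<lambda>q r. r \<le> q"
  have "\<exists>m\<in>S. \<forall>a\<in>S. ?P m a \<longrightarrow> a = m"
  proof (rule predicate_Zorn)
    show "partial_order_on S (relation_of ?P S)"
      by (rule partial_order_on_relation_ofI) auto
  next
    fix C assume C: "C \<in> Chains (relation_of ?P S)"
    then have CS: "C \<subseteq> S" by (auto simp: Chains_def relation_of_def)
    have total: "q \<le> r \<or> r \<le> q" if "q \<in> C" "r \<in> C" for q r
      using C that by (auto simp: Chains_def relation_of_def)
    show "\<exists>u\<in>S. \<forall>a\<in>C. ?P a u"
    proof (cases "C = {}")
      case True
      then show ?thesis using p by (auto simp: S_def)
    next
      case False
      define u where "u x = (INF q\<in>C. q x)" for x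
      have sub: "sublinear q" "q x \<le> p x" if "q \<in> C" for q x
        using CS that by (auto simp: S_def le_fun_def)
      have bdd: "bdd_below ((\<lambda>q. q x) ` C)" for x
      proof (rule bdd_belowI2)
        fix q assume "q \<in> C"
        then show "- p (- x) \<le> q x"
          using sublinearD(4)[OF sub(1), of q x] sub(2)[of q "- x"] by linarith
      qed
      have upper: "u x \<le> q x" if "q \<in> C" for q x
        unfolding u_def by (rule cINF_lower[OF bdd that])
      have greatest: "c \<le> u x" if "\<And>q. q \<in> C \<Longrightarrow> c \<le> q x" for c x
        unfolding u_def using False that by (rule cINF_greatest)
      have "sublinear u"
      proof (rule sublinearI)
        fix x y
        have "u (x + y) - r y \<le> q x" if "q \<in> C" "r \<in> C" for q r
        proof -
          note qr = that
          obtain s where s: "s \<in> C" "s \<le> q" "s \<le> r"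
            using total[OF qr] qr by (metis order_refl)
          have "u (x + y) \<le> s x + s y"
            using upper[OF s(1)] sublinearD(1)[OF sub(1)[OF s(1)]] order_trans by blast
          then show ?thesis using s(2,3) by (smt (verit) le_funD)
        qed
        then have "u (x + y) - r y \<le> u x" if "r \<in> C" for r
          using that greatest by blast
        then have "u (x + y) - u x \<le> u y"
          by (intro greatest) (auto simp: algebra_simps)
        then show "u (x + y) \<le> u x + u y" by simp
      next
        fix t :: real and x assume t: "t > 0"
        have "u (t *\<^sub>R x) / t \<le> q x" if "q \<in> C" for q
          using upper[OF that, of "t *\<^sub>R x"] t sublinearD(2)[OF sub(1)[OF that], of t x]
          by (simp add: field_simps)
        then have "u (t *\<^sub>R x) / t \<le> u x" by (rule greatest)
        then show "u (t *\<^sub>R x) \<le> t * u x" using t by (simp add: field_simps)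
      next
        have "u 0 = (INF q\<in>C. 0)"
          unfolding u_def using sub(1) sublinearD(3) by (intro INF_cong) auto
        then show "u 0 = 0" using False by simp
      qed
      moreover have "u \<le> p"
        using False upper sub(2) by (meson all_not_in_conv le_funI order_trans)
      ultimately show ?thesis
        using upper by (auto simp: S_def le_fun_def)
    qed
  qed
  then obtain m where m: "m \<in> S" and min: "\<And>a. a \<in> S \<Longrightarrow> a \<le> m \<Longrightarrow> a = m" by blast
  have "linear m"
  proof (rule minimal_sublinear_imp_linear)
    show "sublinear m" using m by (simp add: S_def)
    show "r = m" if "sublinear r" "r \<le> m" for r
      using that m min[of r] by (auto simp: S_def)
  qed
  with m show ?thesis by (auto simp: S_def le_fun_def)
qed

text \<open>Mazur--Orlicz form of the Hahn--Banach theorem. A pair \<open>(a, b) \<in> A\<close> encodes the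
  constraint \<open>b \<le> f a\<close>.\<close>

lemma mazur_orlicz:
  fixes A :: "('a::real_vector \<times> real) set"
  assumes p: "sublinear p" and A: "ordering_cone A"
    and le: "\<And>a b. (a, b) \<in> A \<Longrightarrow> b \<le> p a"
  obtains f where "linear f" "\<And>x. f x \<le> p x" "\<And>a b. (a, b) \<in> A \<Longrightarrow> b \<le> f a"
proof -
  let ?q = "\<lambda>x. INF z\<in>A. p (x + fst z) - snd z"
  obtain f where f: "linear f" "\<And>x. f x \<le> ?q x"
    using ex_linear_le_sublinear[OF sublinear_shift(1)[OF p A le]] by auto
  have "f x \<le> p x" for x
    using f(2) sublinear_shift(2)[OF p A le] order_trans by blast
  moreover have "b \<le> f a" if "(a, b) \<in> A" for a b
  proof -
    have "f (- a) \<le> p (- a + a) - b"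
      using f(2) sublinear_shift(3)[OF p A le that] order_trans by blast
    then show ?thesis
      using f(1) by (simp add: sublinearD(3)[OF p] linear_neg)
  qed
  ultimately show ?thesis using that f(1) by blast
qed

section \<open>Supporting functionals, separation of convex sets, duals of normal cones\<close>

lemma ordering_cone_ray:
  "ordering_cone ((\<lambda>t. t *\<^sub>R v) ` {0..})"
proof (rule ordering_coneI)
  show "0 *\<^sub>R v \<in> (\<lambda>t. t *\<^sub>R v) ` {0..}" by (intro imageI) simp
next
  fix x y assume "x \<in> (\<lambda>t. t *\<^sub>R v) ` {0..}" "y \<in> (\<lambda>t. t *\<^sub>R v) ` {0..}"
  then obtain s t where "x + y = (s + t) *\<^sub>R v" "s + t \<in> {0..}"
    by (auto simp: scaleR_add_left)
  then show "x + y \<in> (\<lambda>t. t *\<^sub>R v) ` {0..}" by blast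
next
  fix c :: real and x assume "c \<ge> 0" "x \<in> (\<lambda>t. t *\<^sub>R v) ` {0..}"
  then show "c *\<^sub>R x \<in> (\<lambda>t. t *\<^sub>R v) ` {0..}" by auto
qed

text \<open>The constraint ray through \<open>(x0, p x0)\<close> demands
  \<open>p x0 \<le> f x0\<close>, and the bound by \<open>p\<close> gives the converse.\<close>

lemma linear_le_sublinear_attained:
  assumes p: "sublinear p"
  obtains f where "linear f" "\<And>x. f x \<le> p x" "f x0 = p x0"
proof -
  have "b \<le> p a" if "(a, b) \<in> (\<lambda>t. t *\<^sub>R (x0, p x0)) ` {0..}" for a b
    using that sublinearD(2)[OF p] by auto
  then obtain f where f: "linear f" "\<And>x. f x \<le> p x"
    "\<And>a b. (a, b) \<in> (\<lambda>t. t *\<^sub>R (x0, p x0)) ` {0..} \<Longrightarrow> b \<le> f a"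
    using mazur_orlicz[OF p ordering_cone_ray] by metis
  have "(x0, p x0) \<in> (\<lambda>t. t *\<^sub>R (x0, p x0)) ` {0..}"
    by (rule image_eqI[of _ _ 1]) auto
  then have "p x0 \<le> f x0" by (rule f(3))
  with f that show ?thesis by (meson antisym)
qed

lemma bounded_linear_of_le_norm:
  fixes f :: "'a::real_normed_vector \<Rightarrow> real"
  assumes f: "linear f" and le: "\<And>x. f x \<le> C * norm x"
  shows "bounded_linear f"
proof -
  interpret linear f by fact
  have "\<bar>f x\<bar> \<le> C * norm x" for x
    using le[of x] le[of "- x"] by (simp add: neg)
  then show ?thesis
    by (intro bounded_linear_intro[where K = C]) (auto simp: add scale mult.commute)
qed

lemma sublinear_norm: "C \<ge> 0 \<Longrightarrow> sublinear (\<lambda>x. C * norm x)"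
  by (rule sublinearI) (auto simp: mult_left_mono norm_triangle_ineq mult.left_commute
      simp flip: distrib_left)

text \<open>The constraints demand \<open>d \<le> f (c - y)\<close> for all
  \<open>c \<in> C\<close>. They are compatible with the norm as bound because the ball of radius
  \<open>d\<close> around \<open>y\<close> misses \<open>C\<close>, and they form a cone because
  \<open>C\<close> is convex.\<close>

lemma separation_closed_convex:
  fixes C :: "'a::real_normed_vector set"
  assumes C: "closed C" "convex C" and y: "y \<notin> C"
  obtains f :: "'a \<Rightarrow> real" and d where "bounded_linear f" "d > 0" "\<And>c. c \<in> C \<Longrightarrow> f y + d \<le> f c"
proof -
  obtain d where d: "d > 0" "\<And>c. c \<in> C \<Longrightarrow> d \<le> norm (c - y)"
  proof -
    have "open (- C)" "y \<in> - C" using C y by auto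
    then obtain d where "d > 0" "ball y d \<subseteq> - C" by (meson open_contains_ball)
    then show ?thesis
      by (intro that[of d]) (force simp: subset_iff dist_norm norm_minus_commute not_less[symmetric])+
  qed
  \<comment> \<open>The origin is inserted so that \<open>A\<close> is nonempty even if
    \<open>C\<close> is empty.\<close>
  define A where "A = insert (0, 0) {(t *\<^sub>R (c - y), t * d) |t c. t \<ge> 0 \<and> c \<in> C}"
  have A: "ordering_cone A"
  proof (rule ordering_coneI)
    show "(0, 0) \<in> A" by (simp add: A_def)
  next
    fix u v assume uv: "u \<in> A" "v \<in> A"
    show "u + v \<in> A"
    proof (cases "u = 0 \<or> v = 0")
      case True
      with uv show ?thesis by auto
    next
      case False
      with uv obtain s c t c' where u: "u = (s *\<^sub>R (c - y), s * d)" "s \<ge> 0" "c \<in> C"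
        and v: "v = (t *\<^sub>R (c' - y), t * d)" "t \<ge> 0" "c' \<in> C"
        by (auto simp: A_def zero_prod_def)
      have st: "s + t > 0"
        using False u v by (cases "s = 0"; cases "t = 0") (auto simp: zero_prod_def)
      define c'' where "c'' = (s / (s + t)) *\<^sub>R c + (t / (s + t)) *\<^sub>R c'"
      have "c'' \<in> C"
        unfolding c''_def using C(2) u v st by (intro convexD) (auto simp flip: add_divide_distrib)
      moreover have "(s + t) *\<^sub>R c'' = s *\<^sub>R c + t *\<^sub>R c'"
        using st by (simp add: c''_def scaleR_add_right)
      then have "u + v = ((s + t) *\<^sub>R (c'' - y), (s + t) * d)"
        unfolding u v by (simp add: algebra_simps)
      ultimately show ?thesis using st unfolding A_def by force
    qed
  next
    fix r :: real and u assume r: "r \<ge> 0" and u: "u \<in> A"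
    show "r *\<^sub>R u \<in> A"
    proof (cases "u = 0")
      case False
      with u obtain s c where u: "u = (s *\<^sub>R (c - y), s * d)" "s \<ge> 0" "c \<in> C"
        by (auto simp: A_def zero_prod_def)
      then have "r *\<^sub>R u = ((r * s) *\<^sub>R (c - y), (r * s) * d)" "r * s \<ge> 0"
        using r by auto
      with u(3) show ?thesis unfolding A_def by blast
    qed (auto simp: A_def zero_prod_def)
  qed
  have le: "b \<le> 1 * norm a" if "(a, b) \<in> A" for a b
    using that d by (auto simp: A_def intro!: mult_left_mono)
  obtain f where f: "linear f" "\<And>x. f x \<le> 1 * norm x" "\<And>a b. (a, b) \<in> A \<Longrightarrow> b \<le> f a"
    using mazur_orlicz[OF sublinear_norm[of 1] A le] by auto
  have "f y + d \<le> f c" if "c \<in> C" for c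
  proof -
    have "(1 *\<^sub>R (c - y), 1 * d) \<in> A" using that unfolding A_def by force
    then have "d \<le> f (c - y)" using f(3) by force
    then show ?thesis using f(1) by (simp add: linear_diff)
  qed
  with bounded_linear_of_le_norm[OF f(1,2)] d(1) show ?thesis by (rule that)
qed

lemma weak_limit_in_closed_convex:
  assumes "closed C" "convex C" and u: "\<And>n. u n \<in> C" and lim: "weakly_converges_to u y"
  shows "y \<in> C"
proof (rule ccontr)
  assume "y \<notin> C"
  obtain f :: "_ \<Rightarrow> real" and d where f: "bounded_linear f" "d > 0" "\<And>c. c \<in> C \<Longrightarrow> f y + d \<le> f c"
    by (rule separation_closed_convex[OF assms(1,2) \<open>y \<notin> C\<close>]) blast
  have "(\<lambda>n. f (u n)) \<longlonglongrightarrow> f y"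
    using lim f(1) unfolding weakly_converges_to_def by blast
  then have "f y + d \<le> f y"
    by (rule LIMSEQ_le_const) (use f(3) u in auto)
  with \<open>d > 0\<close> show False by simp
qed

text \<open>M. Krein: the dual cone of a normal cone generates the dual space.\<close>

lemma normal_cone_functional_decomposition:
  fixes K :: "'a::real_normed_vector set"
  assumes K: "normal_cone K" and phi: "bounded_linear (\<phi> :: 'a \<Rightarrow> real)"
  obtains \<psi> :: "'a \<Rightarrow> real" where "bounded_linear \<psi>" "\<And>k. k \<in> K \<Longrightarrow> 0 \<le> \<psi> k" "\<And>k. k \<in> K \<Longrightarrow> \<phi> k \<le> \<psi> k"
proof -
  interpret phi: bounded_linear \<phi> by fact
  obtain C where C: "C > 0" "\<And>x y. x \<in> K \<Longrightarrow> y - x \<in> K \<Longrightarrow> norm x \<le> C * norm y"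
    using K by (auto simp: normal_cone_def cone_le_def)
  obtain B where B: "B > 0" "\<And>x. norm (\<phi> x) \<le> norm x * B"
    using phi.pos_bounded by blast
  have oc: "ordering_cone K" using K by (simp add: normal_cone_def)
  have add: "x + y \<in> K" if "x \<in> K" "y \<in> K" for x y
    using oc that by (simp add: ordering_cone_def)
  have scale: "t *\<^sub>R x \<in> K" if "t \<ge> 0" "x \<in> K" for t x
    using oc that by (simp add: ordering_cone_def cone_def)
  have zero: "0 \<in> K"
    using oc by (rule ordering_cone_zero)
  \<comment> \<open>The constraint is \<open>\<phi> k \<le> \<psi> (k + k')\<close>: taking
    \<open>k' = 0\<close> puts \<open>\<psi>\<close> above \<open>\<phi>\<close> on
    \<open>K\<close>, taking \<open>k = 0\<close> makes it nonnegative there. Normality bounds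
    \<open>norm k\<close> by \<open>C * norm (k + k')\<close>, which makes the constraints
    compatible with a multiple of the norm.\<close>
  define A where "A = {(k + k', \<phi> k) |k k'. k \<in> K \<and> k' \<in> K}"
  have A: "ordering_cone A"
  proof (rule ordering_coneI)
    show "(0 + 0, \<phi> 0) \<in> A" using zero unfolding A_def by blast
  next
    fix u v assume "u \<in> A" "v \<in> A"
    then obtain k k' l l' where "u = (k + k', \<phi> k)" "v = (l + l', \<phi> l)"
      "k \<in> K" "k' \<in> K" "l \<in> K" "l' \<in> K"
      unfolding A_def by blast
    then have "u + v = ((k + l) + (k' + l'), \<phi> (k + l))" "k + l \<in> K" "k' + l' \<in> K"
      using add by (auto simp: phi.add algebra_simps)
    then show "u + v \<in> A" unfolding A_def by blast
  next
    fix t :: real and u assume "t \<ge> 0" "u \<in> A"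
    then obtain k k' where "u = (k + k', \<phi> k)" "k \<in> K" "k' \<in> K"
      unfolding A_def by blast
    then have "t *\<^sub>R u = (t *\<^sub>R k + t *\<^sub>R k', \<phi> (t *\<^sub>R k))" "t *\<^sub>R k \<in> K" "t *\<^sub>R k' \<in> K"
      using scale \<open>t \<ge> 0\<close> by (auto simp: phi.scaleR scaleR_add_right)
    then show "t *\<^sub>R u \<in> A" unfolding A_def by blast
  qed
  have le: "b \<le> (B * C) * norm a" if ab: "(a, b) \<in> A" for a b
  proof -
    obtain k k' where k: "a = k + k'" "b = \<phi> k" "k \<in> K" "k' \<in> K"
      using ab unfolding A_def by blast
    have "b \<le> B * norm k" using B(2)[of k] k(2) by (simp add: mult.commute)
    also have "\<dots> \<le> B * (C * norm a)"
      using B(1) C(2)[of k a] k by (intro mult_left_mono) auto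
    finally show ?thesis by simp
  qed
  have "B * C \<ge> 0" using B(1) C(1) by simp
  then obtain f where f: "linear f" "\<And>x. f x \<le> (B * C) * norm x" "\<And>a b. (a, b) \<in> A \<Longrightarrow> b \<le> f a"
    using mazur_orlicz[OF sublinear_norm A le] by metis
  show ?thesis
  proof
    show "bounded_linear f" using f(1,2) by (rule bounded_linear_of_le_norm)
    fix k assume k: "k \<in> K"
    have "(k + 0, \<phi> k) \<in> A" "(0 + k, \<phi> 0) \<in> A" using k zero unfolding A_def by blast+
    then show "0 \<le> f k" "\<phi> k \<le> f k" using f(3) phi.zero by force+
  qed
qed

section \<open>Directional derivatives under weak sequential completeness\<close>

text \<open>Chord inequalities on the line through \<open>x0\<close>. For the first,
  \<open>x0 + s *\<^sub>R h\<close> lies between \<open>x0\<close> and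
  \<open>x0 + t *\<^sub>R h\<close>; for the second, \<open>x0\<close> lies between
  \<open>x0 - h\<close> and \<open>x0 + s *\<^sub>R h\<close>.\<close>

lemma cone_convex_difference_quotient:
  fixes f :: "'a::real_vector \<Rightarrow> 'b::real_vector" and x0 h :: 'a
  assumes K: "ordering_cone K" and f: "cone_convex K f"
  defines "q \<equiv> \<lambda>s. (f (x0 + s *\<^sub>R h) - f x0) /\<^sub>R s"
  shows "0 < s \<Longrightarrow> s \<le> t \<Longrightarrow> q t - q s \<in> K"
    and "0 < s \<Longrightarrow> q s - (f x0 - f (x0 - h)) \<in> K"
proof -
  have scale: "c *\<^sub>R x \<in> K" if "c \<ge> 0" "x \<in> K" for c x
    using K that by (simp add: ordering_cone_def cone_def)
  have conv: "c *\<^sub>R f x + (1 - c) *\<^sub>R f y - f (c *\<^sub>R x + (1 - c) *\<^sub>R y) \<in> K"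
    if "0 \<le> c" "c \<le> 1" for c x y
    using f that by (simp add: cone_convex_def)
  show "q t - q s \<in> K" if st: "0 < s" "s \<le> t"
  proof -
    define c where "c = s / t"
    have c: "0 \<le> c" "c \<le> 1" "c * t = s" using st by (auto simp: c_def)
    have "c *\<^sub>R (x0 + t *\<^sub>R h) + (1 - c) *\<^sub>R x0 = x0 + s *\<^sub>R h"
      by (simp add: c(3)[symmetric] algebra_simps)
    then have "c *\<^sub>R f (x0 + t *\<^sub>R h) + (1 - c) *\<^sub>R f x0 - f (x0 + s *\<^sub>R h) \<in> K"
      using conv[OF c(1,2), of "x0 + t *\<^sub>R h" x0] by simp
    then have "inverse s *\<^sub>R (c *\<^sub>R f (x0 + t *\<^sub>R h) + (1 - c) *\<^sub>R f x0 - f (x0 + s *\<^sub>R h)) \<in> K"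
      using st by (intro scale) auto
    also have "inverse s *\<^sub>R (c *\<^sub>R f (x0 + t *\<^sub>R h) + (1 - c) *\<^sub>R f x0 - f (x0 + s *\<^sub>R h))
        = (inverse s * c) *\<^sub>R (f (x0 + t *\<^sub>R h) - f x0) - inverse s *\<^sub>R (f (x0 + s *\<^sub>R h) - f x0)"
      by (simp add: algebra_simps)
    also have "inverse s * c = inverse t" using st by (simp add: c_def field_simps)
    finally show ?thesis by (simp add: q_def)
  qed
  show "q s - (f x0 - f (x0 - h)) \<in> K" if s: "0 < s"
  proof -
    define c where "c = 1 / (1 + s)"
    have c: "0 \<le> c" "c \<le> 1" "1 - c = c * s" using s by (auto simp: c_def field_simps)
    have "c *\<^sub>R (x0 + s *\<^sub>R h) + (1 - c) *\<^sub>R (x0 - h) = (c + (1 - c)) *\<^sub>R x0 + (c * s - (1 - c)) *\<^sub>R h"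
      by (simp add: algebra_simps)
    also have "c + (1 - c) = 1" by simp
    also have "c * s - (1 - c) = 0" using c(3) by simp
    finally have "c *\<^sub>R (x0 + s *\<^sub>R h) + (1 - c) *\<^sub>R (x0 - h) = x0" by simp
    then have "c *\<^sub>R f (x0 + s *\<^sub>R h) + (1 - c) *\<^sub>R f (x0 - h) - f x0 \<in> K"
      using conv[OF c(1,2), of "x0 + s *\<^sub>R h" "x0 - h"] by simp
    \<comment> \<open>The factor turns the coefficient of \<open>f (x0 + s *\<^sub>R h)\<close> into
      \<open>inverse s\<close> and that of \<open>f (x0 - h)\<close> into \<open>1\<close>.\<close>
    then have "((1 + s) / s) *\<^sub>R (c *\<^sub>R f (x0 + s *\<^sub>R h) + (1 - c) *\<^sub>R f (x0 - h) - f x0) \<in> K"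
      using s by (intro scale) auto
    also have "((1 + s) / s) *\<^sub>R (c *\<^sub>R f (x0 + s *\<^sub>R h) + (1 - c) *\<^sub>R f (x0 - h) - f x0)
       = ((1 + s) / s * c) *\<^sub>R f (x0 + s *\<^sub>R h) + ((1 + s) / s * (1 - c)) *\<^sub>R f (x0 - h) - ((1 + s) / s) *\<^sub>R f x0"
      by (simp add: scaleR_add_right scaleR_diff_right)
    also have "(1 + s) / s * c = inverse s" using s by (simp add: c_def inverse_eq_divide)
    also have "(1 + s) / s * (1 - c) = 1" unfolding c(3) using s by (simp add: c_def)
    also have "(1 + s) / s = inverse s + 1" using s by (simp add: field_simps)
    finally show ?thesis by (simp add: q_def algebra_simps)
  qed
qed

lemma has_dir_deriv_if_weakly_sequentially_complete:
  fixes f :: "'a::real_vector \<Rightarrow> 'b::real_normed_vector"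
  assumes wsc: "weakly_sequentially_complete TYPE('b)"
    and K: "closed K" "convex K" "normal_cone K" and f: "cone_convex K f"
  shows "\<exists>D. has_dir_deriv f x0 h D"
proof -
  define q where "q s = (f (x0 + s *\<^sub>R h) - f x0) /\<^sub>R s" for s
  define b where "b = f x0 - f (x0 - h)"
  have oc: "ordering_cone K" using K(3) by (simp add: normal_cone_def)
  have add: "x + y \<in> K" if "x \<in> K" "y \<in> K" for x y
    using oc that by (simp add: ordering_cone_def)
  have scale: "c *\<^sub>R x \<in> K" if "c \<ge> 0" "x \<in> K" for c x
    using oc that by (simp add: ordering_cone_def cone_def)
  have mono: "q t - q s \<in> K" if "0 < s" "s \<le> t" for s t
    unfolding q_def using cone_convex_difference_quotient(1)[OF oc f that] .
  have lower: "q s - b \<in> K" if "0 < s" for s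
    unfolding q_def b_def using cone_convex_difference_quotient(2)[OF oc f that] .
  define u where "u n = q (inverse (real (Suc n)))" for n
  have mono_u: "u m - u n \<in> K" if "m \<le> n" for m n
    unfolding u_def using that by (intro mono) (auto intro!: le_imp_inverse_le)
  have conv: "convergent (\<lambda>n. \<psi> (u n))"
    if psi: "bounded_linear \<psi>" "\<And>k. k \<in> K \<Longrightarrow> 0 \<le> \<psi> k" for \<psi> :: "'b \<Rightarrow> real"
  proof -
    interpret bounded_linear \<psi> by fact
    have "decseq (\<lambda>n. \<psi> (u n))"
      using psi(2)[OF mono_u] by (simp add: decseq_def diff)
    moreover have "\<psi> b \<le> \<psi> (u n)" for n
      using psi(2)[OF lower, of "inverse (real (Suc n))"] by (simp add: diff u_def)
    ultimately show ?thesis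
      using decseq_convergent convergentI by metis
  qed
  have "weakly_Cauchy u"
    unfolding weakly_Cauchy_def
  proof (intro allI impI)
    fix \<phi> :: "'b \<Rightarrow> real" assume phi: "bounded_linear \<phi>"
    then obtain \<psi> :: "'b \<Rightarrow> real" where psi: "bounded_linear \<psi>" "\<And>k. k \<in> K \<Longrightarrow> 0 \<le> \<psi> k" "\<And>k. k \<in> K \<Longrightarrow> \<phi> k \<le> \<psi> k"
      using normal_cone_functional_decomposition[OF K(3)] by blast
    \<comment> \<open>Both \<open>\<psi>\<close> and \<open>\<psi> - \<phi>\<close> are nonnegative
      on \<open>K\<close>, so each converges along \<open>u\<close> by monotonicity.\<close>
    have "convergent (\<lambda>n. \<psi> (u n) - (\<psi> (u n) - \<phi> (u n)))"
      using psi by (intro convergent_diff conv[of "\<lambda>x. \<psi> x - \<phi> x"] conv[of \<psi>] bounded_linear_sub phi) auto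
    then show "Cauchy (\<lambda>n. \<phi> (u n))" by (simp add: Cauchy_convergent_iff)
  qed
  then obtain y where y: "weakly_converges_to u y"
    using wsc by (auto simp: weakly_sequentially_complete_def)
  have below: "q s - y \<in> K" if s: "0 < s" for s
  proof -
    obtain N where N: "inverse (real (Suc N)) < s"
      using reals_Archimedean[OF s] by auto
    have "weakly_converges_to (\<lambda>n. q s - u (n + N)) (q s - y)"
      unfolding weakly_converges_to_def
    proof (intro allI impI)
      fix \<phi> :: "'b \<Rightarrow> real" assume phi: "bounded_linear \<phi>"
      then have "(\<lambda>n. \<phi> (u n)) \<longlonglongrightarrow> \<phi> y"
        using y unfolding weakly_converges_to_def by blast
      then have "(\<lambda>n. \<phi> (q s) - \<phi> (u (n + N))) \<longlonglongrightarrow> \<phi> (q s) - \<phi> y"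
        by (intro tendsto_diff tendsto_const LIMSEQ_ignore_initial_segment)
      then show "(\<lambda>n. \<phi> (q s - u (n + N))) \<longlonglongrightarrow> \<phi> (q s - y)"
        using phi by (simp add: bounded_linear.linear linear_diff)
    qed
    moreover have "q s - u (n + N) \<in> K" for n
    proof -
      have "inverse (real (Suc (n + N))) \<le> inverse (real (Suc N))"
        by (intro le_imp_inverse_le) auto
      with N have "inverse (real (Suc (n + N))) \<le> s" by linarith
      then show ?thesis unfolding u_def by (intro mono) auto
    qed
    ultimately show ?thesis by (rule weak_limit_in_closed_convex[OF K(1,2), rotated])
  qed
  \<comment> \<open>Vectors above all sufficiently small quotients. The limit \<open>y\<close> need
    not be one of them, but every \<open>u n\<close> is, so convexity puts \<open>y\<close> into the
    norm closure.\<close>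
  define C where "C = {z. \<exists>s0>0. \<forall>s. 0 < s \<and> s \<le> s0 \<longrightarrow> z - q s \<in> K}"
  have "convex C"
  proof (rule convexI)
    fix z w :: 'b and a c :: real
    assume "z \<in> C" "w \<in> C" and ac: "0 \<le> a" "0 \<le> c" "a + c = 1"
    then obtain s0 s1 where s: "s0 > 0" "\<And>s. 0 < s \<and> s \<le> s0 \<Longrightarrow> z - q s \<in> K"
      "s1 > 0" "\<And>s. 0 < s \<and> s \<le> s1 \<Longrightarrow> w - q s \<in> K"
      by (auto simp: C_def)
    have "a *\<^sub>R z + c *\<^sub>R w - q s \<in> K" if "0 < s" "s \<le> min s0 s1" for s
    proof -
      have "a *\<^sub>R (z - q s) + c *\<^sub>R (w - q s) \<in> K"
        using that s ac by (intro add scale) auto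
      also have "a *\<^sub>R (z - q s) + c *\<^sub>R (w - q s) = a *\<^sub>R z + c *\<^sub>R w - (a + c) *\<^sub>R q s"
        by (simp add: algebra_simps)
      finally show ?thesis using ac by simp
    qed
    then show "a *\<^sub>R z + c *\<^sub>R w \<in> C"
      unfolding C_def using s(1,3) by (intro CollectI exI[of _ "min s0 s1"]) auto
  qed
  moreover have "u n \<in> closure C" for n
  proof -
    have "u n \<in> C"
      unfolding C_def u_def using mono
      by (intro CollectI exI[of _ "inverse (real (Suc n))"]) auto
    then show ?thesis using closure_subset by auto
  qed
  ultimately have y_closure: "y \<in> closure C"
    using weak_limit_in_closed_convex[OF closed_closure convex_closure _ y] by blast
  obtain M where M: "M > 0" "\<And>x y. x \<in> K \<Longrightarrow> y - x \<in> K \<Longrightarrow> norm x \<le> M * norm y"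
    using K(3) by (auto simp: normal_cone_def cone_le_def)
  \<comment> \<open>An argument in the style of Dini: for \<open>z \<in> C\<close> near
    \<open>y\<close> and small \<open>s\<close>, \<open>q s - y\<close> lies between
    \<open>0\<close> and \<open>z - y\<close> for \<open>K\<close>, and normality turns this into a
    norm estimate.\<close>
  have "(q \<longlongrightarrow> y) (at_right 0)"
  proof (rule tendstoI)
    fix e :: real assume e: "e > 0"
    then obtain z where z: "z \<in> C" "dist z y < e / M"
      using y_closure M(1) by (meson closure_approachable divide_pos_pos)
    then obtain s0 where s0: "s0 > 0" "\<And>s. 0 < s \<Longrightarrow> s \<le> s0 \<Longrightarrow> z - q s \<in> K"
      by (auto simp: C_def)
    have "dist (q s) y < e" if "0 < s" "s < s0" for s
    proof -
      have "norm (q s - y) \<le> M * norm (z - y)"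
        using M(2)[OF below, of s "z - y"] s0(2)[of s] that by simp
      also have "\<dots> < e" using z(2) M(1) by (simp add: dist_norm field_simps)
      finally show ?thesis by (simp add: dist_norm)
    qed
    then show "\<forall>\<^sub>F s in at_right 0. dist (q s) y < e"
      using s0(1) eventually_at_right by blast
  qed
  then show ?thesis unfolding has_dir_deriv_def q_def by blast
qed

section \<open>Banach lattices and their positive functionals\<close>

lemma le_pprt: "x \<le> pprt (x :: 'b::lattice_ab_group_add)"
  by (simp add: pprt_def)

lemma pprt_least: "x \<le> y \<Longrightarrow> 0 \<le> y \<Longrightarrow> pprt x \<le> (y :: 'b::lattice_ab_group_add)"
  by (simp add: pprt_def)

lemma pprt_add_le: "pprt (x + y) \<le> pprt x + pprt (y :: 'b::lattice_ab_group_add)"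
  by (intro pprt_least add_mono add_nonneg_nonneg le_pprt) auto

lemma eq_pprt_diff: "x = pprt x - pprt (- (x :: 'b::lattice_ab_group_add))"
  using prts[of x] by (simp add: pprt_neg)

lemma pprt_le_abs: "pprt x \<le> \<bar>x :: 'b::lattice_ab_group_add_abs\<bar>"
  by (intro pprt_least abs_ge_self abs_ge_zero)

lemma sup_eq_pprt: "sup x y = y + pprt (x - (y :: 'b::lattice_ab_group_add))"
  by (simp add: pprt_def add_sup_distrib_left)

lemma pprt_scaleR:
  fixes x :: "'b::banach_lattice"
  assumes "t \<ge> 0"
  shows "pprt (t *\<^sub>R x) = t *\<^sub>R pprt x"
proof -
  have le: "pprt (t *\<^sub>R x) \<le> t *\<^sub>R pprt x" if "t \<ge> 0" for t and x :: 'b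
    using that by (intro pprt_least scaleR_left_mono le_pprt scaleR_nonneg_nonneg) auto
  show ?thesis
  proof (cases "t = 0")
    case False
    with assms have t: "t > 0" by simp
    have "pprt (inverse t *\<^sub>R t *\<^sub>R x) \<le> inverse t *\<^sub>R pprt (t *\<^sub>R x)"
      using t by (intro le) auto
    then have "pprt x \<le> inverse t *\<^sub>R pprt (t *\<^sub>R x)" using t by simp
    then have "t *\<^sub>R pprt x \<le> t *\<^sub>R inverse t *\<^sub>R pprt (t *\<^sub>R x)"
      using t by (intro scaleR_left_mono) auto
    then have "t *\<^sub>R pprt x \<le> pprt (t *\<^sub>R x)" using t by simp
    with le[OF assms] show ?thesis by (intro antisym)
  qed simp
qed

lemma norm_le_of_nonneg: "0 \<le> x \<Longrightarrow> x \<le> y \<Longrightarrow> norm x \<le> norm (y :: 'b::banach_lattice)"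
  by (rule norm_mono_abs) (metis abs_of_nonneg order_trans)

lemma norm_abs_lattice [simp]: "norm \<bar>x\<bar> = norm (x :: 'b::banach_lattice)"
  by (intro antisym norm_mono_abs) auto

lemma norm_pprt_le: "norm (pprt x) \<le> norm (x :: 'b::banach_lattice)"
  using norm_le_of_nonneg[OF zero_le_pprt pprt_le_abs, of x] by simp

lemma pprt_lipschitz: "norm (pprt x - pprt y) \<le> norm (x - (y :: 'b::banach_lattice))"
proof (rule norm_mono_abs)
  have le: "pprt x - pprt y \<le> \<bar>x - y\<bar>" for x y :: 'b
    using pprt_add_le[of y "x - y"] pprt_le_abs[of "x - y"] by (simp add: algebra_simps) (metis add_left_mono order_trans)
  from le[of x y] le[of y x] show "\<bar>pprt x - pprt y\<bar> \<le> \<bar>x - y\<bar>"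
    by (metis abs_leI abs_minus_commute minus_diff_eq)
qed

lemma tendsto_pprt:
  fixes u :: "'c \<Rightarrow> 'b::banach_lattice"
  assumes "(u \<longlongrightarrow> l) F"
  shows "((\<lambda>n. pprt (u n)) \<longlongrightarrow> pprt l) F"
proof -
  have "((\<lambda>n. u n - l) \<longlongrightarrow> 0) F" using assms LIM_zero by blast
  then have "((\<lambda>n. pprt (u n) - pprt l) \<longlongrightarrow> 0) F"
    by (rule Lim_transform_bound[rotated]) (simp add: pprt_lipschitz)
  then show ?thesis by (rule LIM_zero_cancel)
qed

lemma lattice_LIMSEQ_le_const:
  fixes u :: "nat \<Rightarrow> 'b::banach_lattice"
  assumes u: "u \<longlonglongrightarrow> l" and le: "\<And>n. n \<ge> N \<Longrightarrow> a \<le> u n"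
  shows "a \<le> l"
proof -
  have "(\<lambda>n. pprt (a - u n)) \<longlonglongrightarrow> pprt (a - l)"
    by (intro tendsto_pprt tendsto_intros u)
  moreover have "(\<lambda>n. pprt (a - u n)) \<longlonglongrightarrow> 0"
    using le by (intro tendsto_eventually eventually_sequentiallyI[of N]) simp
  ultimately have "pprt (a - l) = 0" using LIMSEQ_unique by blast
  then show ?thesis by (simp add: le_zero_iff_zero_pprt[symmetric])
qed

lemma lattice_LIMSEQ_le_const2:
  fixes u :: "nat \<Rightarrow> 'b::banach_lattice"
  assumes u: "u \<longlonglongrightarrow> l" and le: "\<And>n. n \<ge> N \<Longrightarrow> u n \<le> a"
  shows "l \<le> a"
  using lattice_LIMSEQ_le_const[OF tendsto_minus[OF u], of N "- a"] le by simp

lemma sublinear_norm_pprt: "sublinear (\<lambda>x :: 'b::banach_lattice. norm (pprt x))"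
proof (rule sublinearI)
  fix x y :: 'b
  have "norm (pprt (x + y)) \<le> norm (pprt x + pprt y)"
    by (intro norm_le_of_nonneg pprt_add_le) auto
  also have "\<dots> \<le> norm (pprt x) + norm (pprt y)" by (rule norm_triangle_ineq)
  finally show "norm (pprt (x + y)) \<le> norm (pprt x) + norm (pprt y)" .
qed (auto simp: pprt_scaleR)

definition positive_dual :: "('b::banach_lattice \<Rightarrow> real) set" where
  "positive_dual = {\<phi>. bounded_linear \<phi> \<and> (\<forall>x\<ge>0. 0 \<le> \<phi> x)}"

lemma positive_dual_mono: "\<phi> \<in> positive_dual \<Longrightarrow> x \<le> y \<Longrightarrow> \<phi> x \<le> \<phi> y"
proof -
  assume phi: "\<phi> \<in> positive_dual" and "x \<le> y"
  then have "0 \<le> \<phi> (y - x)" by (simp add: positive_dual_def)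
  also have "\<dots> = \<phi> y - \<phi> x"
    using phi by (simp add: positive_dual_def bounded_linear.linear linear_diff)
  finally show ?thesis by simp
qed

text \<open>A linear functional below \<open>\<lambda>y. norm (pprt y)\<close> is automatically
  positive, because this bound vanishes at negative \<open>y\<close>.\<close>

lemma positive_dual_norm_pprt:
  fixes x :: "'b::banach_lattice"
  obtains \<phi> where "\<phi> \<in> positive_dual" "\<phi> x = norm (pprt x)" "\<And>y. \<phi> y \<le> norm y"
proof -
  obtain f where f: "linear f" "\<And>y. f y \<le> norm (pprt y)" "f x = norm (pprt x)"
    using linear_le_sublinear_attained[OF sublinear_norm_pprt] by metis
  have le: "f y \<le> norm y" for y
    using f(2) norm_pprt_le order_trans by blast
  have "bounded_linear f"
    using f(1) le by (intro bounded_linear_of_le_norm[where C = 1]) auto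
  moreover have "0 \<le> f y" if "0 \<le> y" for y
    using f(2)[of "- y"] that f(1) by (simp add: linear_neg)
  ultimately have "f \<in> positive_dual" by (simp add: positive_dual_def)
  then show ?thesis using f(3) le by (rule that)
qed

text \<open>For \<open>0\<close>, \<open>x\<close>, \<open>y\<close> increasing in \<open>K\<close>,
  the negative parts of \<open>x\<close> and of \<open>y - x\<close> are bounded by values of
  \<open>\<alpha>\<close> that are at most \<open>\<alpha> y \<le> norm y\<close>. Since
  \<open>pprt x \<le> pprt y + pprt (- (y - x))\<close>, the positive part of \<open>x\<close> costs
  \<open>2 * norm y\<close> and the negative part one more, whence the constant
  \<open>3\<close>.\<close>

lemma negative_part_cone:
  fixes \<alpha> :: "'b::banach_lattice \<Rightarrow> real"
  assumes alpha: "\<alpha> \<in> positive_dual" and le: "\<And>y. \<alpha> y \<le> norm y"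
  defines "K \<equiv> {y. norm (pprt (- y)) \<le> \<alpha> y}"
  shows "closed K" "convex K" "normal_cone K"
proof -
  interpret bounded_linear \<alpha> using alpha by (simp add: positive_dual_def)
  have "continuous_on UNIV (\<lambda>y :: 'b. pprt (- y))"
    unfolding continuous_on_def by (auto intro!: tendsto_pprt tendsto_intros)
  then show "closed K"
    unfolding K_def by (intro closed_Collect_le continuous_intros) (auto intro: linear_continuous_on bounded_linear_axioms)
  have oc: "ordering_cone K"
  proof (rule ordering_coneI)
    show "0 \<in> K" by (simp add: K_def zero)
  next
    fix x y assume "x \<in> K" "y \<in> K"
    then show "x + y \<in> K"
      using sublinearD(1)[OF sublinear_norm_pprt, of "- x" "- y"] by (simp add: K_def add)
  next
    fix t :: real and x assume "t \<ge> 0" "x \<in> K"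
    then show "t *\<^sub>R x \<in> K"
      using pprt_scaleR[of t "- x"] by (simp add: K_def scaleR mult_left_mono)
  qed
  then show "convex K" by (simp add: ordering_cone_iff_convex_cone convex_cone_def)
  have "norm x \<le> 3 * norm y" if "x \<in> K" "y - x \<in> K" for x y
  proof -
    have x: "norm (pprt (- x)) \<le> \<alpha> x" and yx: "norm (pprt (- (y - x))) \<le> \<alpha> y - \<alpha> x"
      using that by (auto simp: K_def diff)
    have bounds: "\<alpha> x \<le> norm y" "\<alpha> y - \<alpha> x \<le> norm y"
      using x yx le[of y] norm_ge_zero[of "pprt (- x)"] norm_ge_zero[of "pprt (- (y - x))"] by linarith+
    have "pprt x \<le> pprt y + pprt (- (y - x))"
      using pprt_add_le[of y "- (y - x)"] by simp
    then have "norm (pprt x) \<le> norm (pprt y + pprt (- (y - x)))"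
      by (intro norm_le_of_nonneg) auto
    also have "\<dots> \<le> norm (pprt y) + norm (pprt (- (y - x)))" by (rule norm_triangle_ineq)
    also have "\<dots> \<le> norm y + norm y"
      using norm_pprt_le[of y] yx bounds by linarith
    finally have "norm (pprt x - pprt (- x)) \<le> 3 * norm y"
      using norm_triangle_ineq4[of "pprt x" "pprt (- x)"] x bounds by linarith
    then show ?thesis by (simp flip: eq_pprt_diff)
  qed
  then have "\<exists>C>0. \<forall>x y. cone_le K 0 x \<and> cone_le K x y \<longrightarrow> norm x \<le> C * norm y"
    unfolding cone_le_def by (intro exI[of _ 3]) simp
  with oc show "normal_cone K" by (simp add: normal_cone_def)
qed

text \<open>Kantorovich--Banach spaces, in sequential form. The version for directed sets is
  recovered in \<open>kb_space_directed_sup\<close>.\<close>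

definition kb_space :: "'b::banach_lattice itself \<Rightarrow> bool" where
  "kb_space _ \<longleftrightarrow> (\<forall>u :: nat \<Rightarrow> 'b. incseq u \<longrightarrow> Bseq u \<longrightarrow> convergent u)"

section \<open>Operations preserving convexity for a cone\<close>

lemma cone_convex_add:
  assumes "ordering_cone K" "cone_convex K f" "cone_convex K g"
  shows "cone_convex K (\<lambda>x. f x + g x)"
  unfolding cone_convex_def
proof (intro allI ballI)
  fix x y and t :: real assume t: "t \<in> {0..1}"
  have "(t *\<^sub>R f x + (1 - t) *\<^sub>R f y - f (t *\<^sub>R x + (1 - t) *\<^sub>R y)) +
      (t *\<^sub>R g x + (1 - t) *\<^sub>R g y - g (t *\<^sub>R x + (1 - t) *\<^sub>R y)) \<in> K"
    using assms t by (simp add: cone_convex_def ordering_cone_def)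
  then show "t *\<^sub>R (f x + g x) + (1 - t) *\<^sub>R (f y + g y) - (f (t *\<^sub>R x + (1 - t) *\<^sub>R y) + g (t *\<^sub>R x + (1 - t) *\<^sub>R y)) \<in> K"
    by (simp add: algebra_simps)
qed

lemma cone_convex_sum:
  assumes "ordering_cone K" "\<And>i. i \<in> I \<Longrightarrow> cone_convex K (f i)"
  shows "cone_convex K (\<lambda>x. \<Sum>i\<in>I. f i x)"
  using assms(2)
proof (induction I rule: infinite_finite_induct)
  case (insert i I)
  then show ?case by (simp add: cone_convex_add[OF assms(1)])
qed (auto simp: cone_convex_def ordering_cone_zero[OF assms(1)])

lemma cone_convex_limit:
  fixes g :: "nat \<Rightarrow> 'a::real_vector \<Rightarrow> 'b::real_normed_vector"
  assumes "closed K" "\<And>n. cone_convex K (g n)" "\<And>x. (\<lambda>n. g n x) \<longlonglongrightarrow> f x"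
  shows "cone_convex K f"
  unfolding cone_convex_def
proof (intro allI ballI)
  fix x y and t :: real assume t: "t \<in> {0..1}"
  have "(\<lambda>n. t *\<^sub>R g n x + (1 - t) *\<^sub>R g n y - g n (t *\<^sub>R x + (1 - t) *\<^sub>R y))
      \<longlonglongrightarrow> t *\<^sub>R f x + (1 - t) *\<^sub>R f y - f (t *\<^sub>R x + (1 - t) *\<^sub>R y)"
    by (intro tendsto_intros assms(3))
  moreover have "t *\<^sub>R g n x + (1 - t) *\<^sub>R g n y - g n (t *\<^sub>R x + (1 - t) *\<^sub>R y) \<in> K" for n
    using assms(2) t by (simp add: cone_convex_def)
  ultimately show "t *\<^sub>R f x + (1 - t) *\<^sub>R f y - f (t *\<^sub>R x + (1 - t) *\<^sub>R y) \<in> K"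
    by (rule closed_sequentially[OF assms(1), rotated])
qed

lemma cone_convex_hinge:
  fixes v :: "'b::real_vector"
  assumes K: "ordering_cone K" and v: "v \<in> K"
  shows "cone_convex K (\<lambda>s. max (s - a) 0 *\<^sub>R v)"
  unfolding cone_convex_def
proof (intro allI ballI)
  fix x y t :: real assume t: "t \<in> {0..1}"
  define c where "c = t * max (x - a) 0 + (1 - t) * max (y - a) 0 - max (t *\<^sub>R x + (1 - t) *\<^sub>R y - a) 0"
  have "t * (x - a) + (1 - t) * (y - a) \<le> t * max (x - a) 0 + (1 - t) * max (y - a) 0"
    using t by (intro add_mono mult_left_mono) auto
  moreover have "0 \<le> t * max (x - a) 0 + (1 - t) * max (y - a) 0"
    using t by auto
  moreover have "t * (x - a) + (1 - t) * (y - a) = t *\<^sub>R x + (1 - t) *\<^sub>R y - a"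
    by (simp add: algebra_simps)
  ultimately have "c \<ge> 0" by (simp add: c_def)
  then have "c *\<^sub>R v \<in> K" using K v by (simp add: ordering_cone_def cone_def)
  then show "t *\<^sub>R max (x - a) 0 *\<^sub>R v + (1 - t) *\<^sub>R max (y - a) 0 *\<^sub>R v
      - max (t *\<^sub>R x + (1 - t) *\<^sub>R y - a) 0 *\<^sub>R v \<in> K"
    by (simp add: c_def scaleR_add_left scaleR_diff_left)
qed

lemma cone_convex_comp_linear:
  assumes "linear l" "cone_convex K g"
  shows "cone_convex K (\<lambda>x. g (l x))"
  using assms by (simp add: cone_convex_def linear_add linear_scale)

section \<open>Monotone norm-bounded sequences converge if directional derivatives exist\<close>

text \<open>The function depends on \<open>x\<close> only through a linear functional with value
  \<open>1\<close> at \<open>h\<close>, so everything happens on the real line. There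
  \<open>g\<close> has slope close to \<open>y0 - (u (Suc n) - u 0)\<close> between \<open>0\<close>
  and \<open>a n\<close>, so its right derivative at \<open>0\<close> can exist only if
  \<open>u\<close> converges.\<close>

lemma kb_space_if_dir_deriv:
  fixes h :: "'a::real_vector"
  assumes h: "h \<noteq> 0"
    and deriv: "\<And>(K :: 'b::banach_lattice set) (f :: 'a \<Rightarrow> 'b).
      closed K \<Longrightarrow> convex K \<Longrightarrow> normal_cone K \<Longrightarrow> cone_convex K f \<Longrightarrow> \<exists>D. has_dir_deriv f 0 h D"
  shows "kb_space TYPE('b)"
  unfolding kb_space_def
proof (intro allI impI)
  fix u :: "nat \<Rightarrow> 'b" assume inc: "incseq u" and bdd: "Bseq u"
  show "convergent u"
  proof (cases "\<forall>x :: 'b. x = 0")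
    case True
    then have "u = (\<lambda>n. 0)" by auto
    then show ?thesis by (simp add: convergent_const)
  next
    case False
    then obtain x :: 'b where x: "x \<noteq> 0" by auto
    define e where "e = \<bar>x\<bar>"
    have e: "0 \<le> e" "norm e > 0" using x by (auto simp: e_def)
    obtain M where M: "M > 0" "\<And>n. norm (u n) \<le> M"
      using bdd by (auto simp: Bseq_def)
    obtain \<alpha> :: "'b \<Rightarrow> real" where alpha: "\<alpha> \<in> positive_dual" "\<alpha> e = norm (pprt e)" "\<And>y. \<alpha> y \<le> norm y"
      using positive_dual_norm_pprt by blast
    have lin: "linear \<alpha>"
      using alpha(1) by (simp add: positive_dual_def bounded_linear.linear)
    define K where "K = {y. norm (pprt (- y)) \<le> \<alpha> y}"
    have K: "closed K" "convex K" "normal_cone K"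
      unfolding K_def using negative_part_cone[OF alpha(1,3)] by auto
    then have oc: "ordering_cone K" by (simp add: normal_cone_def)
    define d where "d k = u (Suc k) - u k" for k
    have d: "0 \<le> d k" "norm (d k) \<le> 2 * M" for k
    proof -
      show "0 \<le> d k" using inc by (simp add: d_def incseq_SucD)
      show "norm (d k) \<le> 2 * M"
        using norm_triangle_ineq4[of "u (Suc k)" "u k"] M(2)[of k] M(2)[of "Suc k"] by (simp add: d_def)
    qed
    have d_sum: "(\<Sum>k<n. d k) = u n - u 0" for n
      unfolding d_def by (rule sum_lessThan_telescope)
    have dK: "d k \<in> K" for k
    proof -
      have "0 \<le> \<alpha> (d k)" using alpha(1) d(1) by (simp add: positive_dual_def)
      then show ?thesis using d(1)[of k] by (simp add: K_def)
    qed
    \<comment> \<open>A partial sum \<open>s\<close> of the increments has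
      \<open>norm s \<le> 2 * M\<close>. For \<open>y0 - s \<in> K\<close> the value
      \<open>\<alpha> y0 - \<alpha> s\<close> must pay for a negative part of norm at most
      \<open>2 * M\<close>, and \<open>\<alpha> s\<close> may use up another
      \<open>2 * M\<close>.\<close>
    define y0 where "y0 = (4 * M / norm e) *\<^sub>R e"
    have y0: "0 \<le> y0" "\<alpha> y0 = 4 * M"
      using e M(1) lin alpha(2) by (auto simp: y0_def linear_scale intro!: scaleR_nonneg_nonneg)
    have y0K: "y0 - (\<Sum>k<n. d k) \<in> K" for n
    proof -
      let ?s = "\<Sum>k<n. d k"
      have s: "0 \<le> ?s" by (intro sum_nonneg d)
      have s2: "norm ?s \<le> 2 * M"
        using norm_triangle_ineq4[of "u n" "u 0"] M(2)[of n] M(2)[of 0] by (simp add: d_sum)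
      have "pprt (- (y0 - ?s)) \<le> ?s" using y0(1) s by (intro pprt_least) auto
      then have "norm (pprt (- (y0 - ?s))) \<le> norm ?s" by (intro norm_le_of_nonneg) auto
      also have "\<dots> \<le> 4 * M - 2 * M" using s2 by simp
      also have "\<dots> \<le> \<alpha> (y0 - ?s)"
        using alpha(3)[of ?s] s2 y0(2) lin by (simp add: linear_diff)
      finally show ?thesis by (simp add: K_def)
    qed
    \<comment> \<open>The exponent is quadratic so that \<open>a (Suc n) / a n\<close> tends to
      \<open>0\<close>. At scale \<open>a n\<close> the increments after the \<open>n\<close>-th are
      then negligible, which a geometric sequence would not achieve.\<close>
    define a :: "nat \<Rightarrow> real" where "a k = (1/2) ^ (k * k)" for k
    have a_pos: "a k > 0" for k by (simp add: a_def)
    have a_mono: "a k \<le> a n" if "n \<le> k" for n k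
      unfolding a_def using that by (intro power_decreasing mult_le_mono) auto
    have a_le: "a k \<le> (1/2) ^ k" for k
      unfolding a_def by (intro power_decreasing) auto
    define m where "m s k = min (max s 0) (a k)" for s k
    have m_bound: "norm (m s k *\<^sub>R d k) \<le> a k * (2 * M)" for s k
      unfolding norm_scaleR using d(2)[of k] a_pos[of k] by (intro mult_mono) (auto simp: m_def)
    have summable_a: "summable (\<lambda>k. a k * (2 * M))"
    proof (rule summable_comparison_test')
      show "summable (\<lambda>k. (1/2) ^ k * (2 * M))"
        by (intro summable_mult2 summable_geometric) auto
      show "norm (a k * (2 * M)) \<le> (1/2) ^ k * (2 * M)" if "k \<ge> 0" for k
        using a_le[of k] a_pos[of k] M(1) by (auto intro!: mult_right_mono)
    qed
    have summable_m: "summable (\<lambda>k. m s k *\<^sub>R d k)" for s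
      by (rule summable_comparison_test'[OF summable_a, of 0]) (rule m_bound)
    define g where "g s = max s 0 *\<^sub>R y0 - (\<Sum>k. m s k *\<^sub>R d k)" for s
    have "cone_convex K g"
    proof (rule cone_convex_limit[OF K(1)])
      fix n
      \<comment> \<open>Each \<open>- m s k *\<^sub>R d k\<close> is concave at \<open>0\<close> and
        convex at \<open>a k\<close>. The negative slopes at \<open>0\<close> are collected in the
        coefficient \<open>y0 - (\<Sum>k<n. d k)\<close>, which lies in \<open>K\<close> by the
        choice of \<open>y0\<close>; the remaining hinges have coefficients
        \<open>d k \<in> K\<close>.\<close>
      have "cone_convex K (\<lambda>s. max (s - 0) 0 *\<^sub>R (y0 - (\<Sum>k<n. d k)) + (\<Sum>k<n. max (s - a k) 0 *\<^sub>R d k))"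
        by (intro cone_convex_add[OF oc] cone_convex_sum[OF oc] cone_convex_hinge[OF oc] y0K dK)
      also have "(\<lambda>s. max (s - 0) 0 *\<^sub>R (y0 - (\<Sum>k<n. d k)) + (\<Sum>k<n. max (s - a k) 0 *\<^sub>R d k))
          = (\<lambda>s. max s 0 *\<^sub>R y0 - (\<Sum>k<n. m s k *\<^sub>R d k))"
      proof
        fix s :: real
        have "m s k = max s 0 - max (s - a k) 0" for k
          using a_pos[of k] by (auto simp: m_def)
        then have "(\<Sum>k<n. m s k *\<^sub>R d k) = max s 0 *\<^sub>R (\<Sum>k<n. d k) - (\<Sum>k<n. max (s - a k) 0 *\<^sub>R d k)"
          by (simp add: scaleR_diff_left sum_subtractf scaleR_sum_right)
        then show "max (s - 0) 0 *\<^sub>R (y0 - (\<Sum>k<n. d k)) + (\<Sum>k<n. max (s - a k) 0 *\<^sub>R d k)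
            = max s 0 *\<^sub>R y0 - (\<Sum>k<n. m s k *\<^sub>R d k)"
          by (simp add: scaleR_diff_right)
      qed
      finally show "cone_convex K (\<lambda>s. max s 0 *\<^sub>R y0 - (\<Sum>k<n. m s k *\<^sub>R d k))" .
    next
      fix s show "(\<lambda>n. max s 0 *\<^sub>R y0 - (\<Sum>k<n. m s k *\<^sub>R d k)) \<longlonglongrightarrow> g s"
        unfolding g_def by (intro tendsto_intros summable_LIMSEQ summable_m)
    qed
    moreover have "independent {h}" using h by simp
    then obtain l :: "'a \<Rightarrow> real" where l: "linear l" "l h = 1"
      using linear_independent_extend[of "{h}" "\<lambda>_. 1"] by auto
    ultimately have "cone_convex K (\<lambda>x. g (l x))" using cone_convex_comp_linear by blast
    then obtain D where "has_dir_deriv (\<lambda>x. g (l x)) 0 h D"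
      using deriv K by blast
    moreover have "m 0 k = 0" for k using a_pos[of k] by (simp add: m_def)
    then have "g 0 = 0" by (simp add: g_def)
    ultimately have lim: "((\<lambda>t. g t /\<^sub>R t) \<longlongrightarrow> D) (at_right 0)"
      using l by (simp add: has_dir_deriv_def linear_0 linear_scale)
    have "a \<longlonglongrightarrow> 0"
    proof (rule Lim_null_comparison)
      show "(\<lambda>n. (1/2 :: real) ^ n) \<longlonglongrightarrow> 0" by (rule LIMSEQ_power_zero) simp
      show "\<forall>\<^sub>F n in sequentially. norm (a n) \<le> (1/2) ^ n"
        using a_le a_pos by (simp add: less_imp_le)
    qed
    then have "filterlim a (at_right 0) sequentially"
      using a_pos by (simp add: filterlim_at less_imp_neq[symmetric])
    then have "(\<lambda>n. g (a n) /\<^sub>R a n) \<longlonglongrightarrow> D"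
      using lim by (rule filterlim_compose[rotated])
    \<comment> \<open>At \<open>s = a n\<close> the terms with \<open>k \<le> n\<close> are
      truncated at \<open>a n\<close> itself and telescope to \<open>u (Suc n) - u 0\<close>. The
      error is the sum of the later terms divided by \<open>a n\<close>.\<close>
    have tail: "norm (u (Suc n) - (u 0 + y0 - g (a n) /\<^sub>R a n)) \<le> 4 * M * (1/2) ^ n" for n
    proof -
      have split: "(\<Sum>k. m (a n) k *\<^sub>R d k) = (\<Sum>k. m (a n) (k + Suc n) *\<^sub>R d (k + Suc n)) + (\<Sum>k<Suc n. m (a n) k *\<^sub>R d k)"
        by (rule suminf_split_initial_segment[OF summable_m])
      have "(\<Sum>k<Suc n. m (a n) k *\<^sub>R d k) = (\<Sum>k<Suc n. a n *\<^sub>R d k)"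
        using a_mono a_pos by (intro sum.cong) (auto simp: m_def less_imp_le min_absorb1)
      also have "\<dots> = a n *\<^sub>R (u (Suc n) - u 0)"
        unfolding scaleR_sum_right[symmetric] d_sum ..
      finally have head: "(\<Sum>k<Suc n. m (a n) k *\<^sub>R d k) = a n *\<^sub>R (u (Suc n) - u 0)" .
      have "g (a n) /\<^sub>R a n = y0 - (u (Suc n) - u 0) - (\<Sum>k. m (a n) (k + Suc n) *\<^sub>R d (k + Suc n)) /\<^sub>R a n"
        unfolding g_def split head using a_pos[of n] by (simp add: algebra_simps)
      then have eq: "u (Suc n) - (u 0 + y0 - g (a n) /\<^sub>R a n) = - ((\<Sum>k. m (a n) (k + Suc n) *\<^sub>R d (k + Suc n)) /\<^sub>R a n)"
        by simp
      have "norm (\<Sum>k. m (a n) (k + Suc n) *\<^sub>R d (k + Suc n)) \<le> (\<Sum>k. a n * (1/2) ^ n * M * (1/2) ^ k * 2)"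
      proof (rule norm_suminf_le)
        fix k
        have "n * n + (n + Suc k) \<le> (k + Suc n) * (k + Suc n)" by (simp add: algebra_simps)
        then have "a (k + Suc n) \<le> a n * (1/2) ^ (n + Suc k)"
          unfolding a_def power_add[symmetric] by (intro power_decreasing) auto
        then have "a (k + Suc n) * (2 * M) \<le> a n * (1/2) ^ (n + Suc k) * (2 * M)"
          using M(1) by (intro mult_right_mono) auto
        also have "\<dots> \<le> a n * (1/2) ^ n * M * (1/2) ^ k * 2"
          using a_pos[of n] M(1) by (simp add: power_add)
        finally show "norm (m (a n) (k + Suc n) *\<^sub>R d (k + Suc n)) \<le> a n * (1/2) ^ n * M * (1/2) ^ k * 2"
          using m_bound order_trans by blast
      qed (intro summable_mult summable_mult2 summable_geometric, auto)
      also have "\<dots> = a n * (4 * M * (1/2) ^ n)"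
        by (simp add: suminf_mult suminf_mult2[symmetric] suminf_geometric summable_mult summable_geometric)
      finally show ?thesis
        unfolding eq using a_pos[of n] by (simp add: field_simps)
    qed
    have "(\<lambda>n. u (Suc n) - (u 0 + y0 - g (a n) /\<^sub>R a n)) \<longlonglongrightarrow> 0"
    proof (rule Lim_null_comparison)
      show "(\<lambda>n. 4 * M * (1/2) ^ n) \<longlonglongrightarrow> 0"
        by (intro tendsto_mult_right_zero LIMSEQ_power_zero) auto
    qed (use tail in \<open>auto intro: always_eventually\<close>)
    then have "(\<lambda>n. u (Suc n) - (u 0 + y0 - g (a n) /\<^sub>R a n) + (u 0 + y0 - g (a n) /\<^sub>R a n))
        \<longlonglongrightarrow> 0 + (u 0 + y0 - D)"
      using \<open>(\<lambda>n. g (a n) /\<^sub>R a n) \<longlonglongrightarrow> D\<close> by (intro tendsto_intros)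
    then have "(\<lambda>n. u (Suc n)) \<longlonglongrightarrow> u 0 + y0 - D" by simp
    then show ?thesis by (metis LIMSEQ_imp_Suc convergentI)
  qed
qed

section \<open>Order intervals of functionals\<close>

definition dual_interval :: "('b::banach_lattice \<Rightarrow> real) \<Rightarrow> ('b \<Rightarrow> real) set" where
  "dual_interval \<phi> = {\<psi>. bounded_linear \<psi> \<and> (\<forall>x\<ge>0. 0 \<le> \<psi> x \<and> \<psi> x \<le> \<phi> x)}"

lemma dual_interval_imp_positive_dual: "\<psi> \<in> dual_interval \<phi> \<Longrightarrow> \<psi> \<in> positive_dual"
  by (simp add: dual_interval_def positive_dual_def)

lemma positive_dual_linear: "\<phi> \<in> positive_dual \<Longrightarrow> linear \<phi>"
  by (simp add: positive_dual_def bounded_linear.linear)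

lemma positive_dual_nonneg: "\<phi> \<in> positive_dual \<Longrightarrow> 0 \<le> x \<Longrightarrow> 0 \<le> \<phi> x"
  by (simp add: positive_dual_def)

lemma positive_dual_add:
  "\<phi> \<in> positive_dual \<Longrightarrow> \<psi> \<in> positive_dual \<Longrightarrow> (\<lambda>x. \<phi> x + \<psi> x) \<in> positive_dual"
  by (auto simp: positive_dual_def bounded_linear_add)

lemma positive_dual_scale:
  "\<phi> \<in> positive_dual \<Longrightarrow> t \<ge> 0 \<Longrightarrow> (\<lambda>x. t * \<phi> x) \<in> positive_dual"
  by (auto simp: positive_dual_def bounded_linear_const_mult)

lemma dual_interval_trans:
  "\<xi> \<in> dual_interval \<psi> \<Longrightarrow> \<psi> \<in> dual_interval \<phi> \<Longrightarrow> \<xi> \<in> dual_interval \<phi>"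
  by (auto simp: dual_interval_def intro: order_trans)

lemma zero_in_dual_interval: "\<phi> \<in> positive_dual \<Longrightarrow> (\<lambda>_. 0) \<in> dual_interval \<phi>"
  by (simp add: dual_interval_def positive_dual_def)

lemma self_in_dual_interval: "\<phi> \<in> positive_dual \<Longrightarrow> \<phi> \<in> dual_interval \<phi>"
  by (simp add: dual_interval_def positive_dual_def)

lemma dual_interval_diff:
  "\<phi> \<in> positive_dual \<Longrightarrow> \<psi> \<in> dual_interval \<phi> \<Longrightarrow> (\<lambda>x. \<phi> x - \<psi> x) \<in> dual_interval \<phi>"
  by (auto simp: dual_interval_def positive_dual_def bounded_linear_sub)

lemma sublinear_positive_dual_pprt:
  assumes "\<phi> \<in> positive_dual"
  shows "sublinear (\<lambda>x. \<phi> (pprt x))"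
proof (rule sublinearI)
  fix x y
  show "\<phi> (pprt (x + y)) \<le> \<phi> (pprt x) + \<phi> (pprt y)"
    using positive_dual_mono[OF assms pprt_add_le, of x y] linear_add[OF positive_dual_linear[OF assms]]
    by simp
qed (use positive_dual_linear[OF assms] in \<open>auto simp: pprt_scaleR linear_scale linear_0\<close>)

text \<open>Boundedness comes for free: dropping the negative part of \<open>x\<close> gives
  \<open>f x \<le> f (pprt x) \<le> \<phi> (pprt x)\<close>.\<close>

lemma dual_intervalI:
  assumes phi: "\<phi> \<in> positive_dual" and f: "linear f" "\<And>x. 0 \<le> x \<Longrightarrow> 0 \<le> f x" "\<And>x. 0 \<le> x \<Longrightarrow> f x \<le> \<phi> x"
  shows "f \<in> dual_interval \<phi>"
proof -
  interpret phi: bounded_linear \<phi> using phi by (simp add: positive_dual_def)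
  obtain B where B: "B > 0" "\<And>x. norm (\<phi> x) \<le> norm x * B"
    using phi.pos_bounded by blast
  have "f x \<le> B * norm x" for x
  proof -
    have "f x = f (pprt x) - f (pprt (- x))"
      using f(1) by (metis eq_pprt_diff linear_diff)
    also have "\<dots> \<le> \<phi> (pprt x)" using f(2)[of "pprt (- x)"] f(3)[of "pprt x"] by simp
    also have "\<dots> \<le> norm (pprt x) * B" using B(2)[of "pprt x"] by simp
    also have "\<dots> \<le> norm x * B" using B(1) norm_pprt_le by (intro mult_right_mono) auto
    finally show ?thesis by (simp add: mult.commute)
  qed
  then have "bounded_linear f" using f(1) by (intro bounded_linear_of_le_norm)
  with f show ?thesis by (simp add: dual_interval_def)
qed

text \<open>The single bound encodes both halves of the interval, at negative \<open>x\<close>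
  positivity of \<open>f\<close> and at positive \<open>x\<close> domination by
  \<open>\<phi>\<close>. This makes order intervals accessible to
  \<open>mazur_orlicz\<close>.\<close>

lemma dual_intervalI_pprt:
  assumes phi: "\<phi> \<in> positive_dual" and f: "linear f" "\<And>x. f x \<le> \<phi> (pprt x)"
  shows "f \<in> dual_interval \<phi>"
proof (rule dual_intervalI[OF phi f(1)])
  fix x :: 'a assume x: "0 \<le> x"
  have "f (- x) \<le> 0"
    using f(2)[of "- x"] x linear_0[OF positive_dual_linear[OF phi]] by simp
  then show "0 \<le> f x" using f(1) by (simp add: linear_neg)
  show "f x \<le> \<phi> x" using f(2)[of x] x by simp
qed

text \<open>Weak-* compactness of \<open>dual_interval \<phi>\<close>, in the only form needed: eventual
  lower bounds along a sequence survive in some limit functional.\<close>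

lemma dual_interval_cluster:
  assumes phi: "\<phi> \<in> positive_dual" and psi: "\<And>j :: nat. \<psi> j \<in> dual_interval \<phi>"
  shows "\<exists>f\<in>dual_interval \<phi>. \<forall>a b. ((\<forall>\<^sub>F j in sequentially. b \<le> \<psi> j a) \<longrightarrow> b \<le> f a) \<and>
    ((\<forall>\<^sub>F j in sequentially. \<psi> j a \<le> b) \<longrightarrow> f a \<le> b)"
proof -
  have lin: "linear (\<psi> j)" for j
    using psi by (simp add: dual_interval_def bounded_linear.linear)
  define A where "A = {(a, b). \<forall>\<^sub>F j in sequentially. b \<le> \<psi> j a}"
  have A: "ordering_cone A"
  proof (rule ordering_coneI)
    show "(0, 0) \<in> A" by (simp add: A_def linear_0[OF lin])
  next
    fix u v assume "u \<in> A" "v \<in> A"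
    then have "\<forall>\<^sub>F j in sequentially. snd u \<le> \<psi> j (fst u)" "\<forall>\<^sub>F j in sequentially. snd v \<le> \<psi> j (fst v)"
      by (auto simp: A_def)
    then have "\<forall>\<^sub>F j in sequentially. snd u + snd v \<le> \<psi> j (fst u + fst v)"
      by eventually_elim (simp add: linear_add[OF lin])
    then show "u + v \<in> A" by (simp add: A_def case_prod_beta)
  next
    fix t :: real and u assume t: "t \<ge> 0" and "u \<in> A"
    then have "\<forall>\<^sub>F j in sequentially. snd u \<le> \<psi> j (fst u)" by (auto simp: A_def)
    then have "\<forall>\<^sub>F j in sequentially. t * snd u \<le> \<psi> j (t *\<^sub>R fst u)"
      by eventually_elim (simp add: linear_scale[OF lin] t mult_left_mono)
    then show "t *\<^sub>R u \<in> A" by (simp add: A_def case_prod_beta)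
  qed
  have le: "b \<le> \<phi> (pprt a)" if "(a, b) \<in> A" for a b
  proof -
    have "\<psi> j a \<le> \<phi> (pprt a)" for j
    proof -
      have "\<psi> j a \<le> \<psi> j (pprt a)"
        using dual_interval_imp_positive_dual[OF psi] le_pprt by (rule positive_dual_mono)
      also have "\<dots> \<le> \<phi> (pprt a)" using psi by (simp add: dual_interval_def)
      finally show ?thesis .
    qed
    moreover have "\<exists>j. b \<le> \<psi> j a"
      using eventually_happens'[OF sequentially_bot, of "\<lambda>j. b \<le> \<psi> j a"] that by (auto simp: A_def)
    ultimately show ?thesis using order_trans by blast
  qed
  obtain f where f: "linear f" "\<And>x. f x \<le> \<phi> (pprt x)" "\<And>a b. (a, b) \<in> A \<Longrightarrow> b \<le> f a"
    using mazur_orlicz[OF sublinear_positive_dual_pprt[OF phi] A le] by blast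
  show ?thesis
  proof (intro bexI allI conjI impI)
    show "f \<in> dual_interval \<phi>" using phi f(1,2) by (rule dual_intervalI_pprt)
    show lower: "b \<le> f a" if "\<forall>\<^sub>F j in sequentially. b \<le> \<psi> j a" for a b
      using that by (intro f(3)) (simp add: A_def)
    show "f a \<le> b" if "\<forall>\<^sub>F j in sequentially. \<psi> j a \<le> b" for a b
      using lower[of "- b" "- a"] that f(1) by (simp add: linear_neg lin)
  qed
qed

text \<open>The Riesz--Kantorovich formula. The supremum of \<open>f\<close> over the interval from
  \<open>0\<close> to \<open>pprt x\<close> is sublinear on the whole space, so a linear
  \<open>g\<close> below it that dominates \<open>f\<close> on positive vectors exists; the last
  conclusion identifies \<open>g\<close> with the supremum on positive \<open>x\<close>.\<close>

lemma dual_positive_part: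
  fixes f :: "'b::banach_lattice \<Rightarrow> real"
  assumes f: "bounded_linear f"
  obtains g where "g \<in> positive_dual" "\<And>x. 0 \<le> x \<Longrightarrow> f x \<le> g x"
    "\<And>x c. 0 \<le> x \<Longrightarrow> (\<And>a. 0 \<le> a \<Longrightarrow> a \<le> x \<Longrightarrow> f a \<le> c) \<Longrightarrow> g x \<le> c"
proof -
  interpret bounded_linear f by fact
  obtain B where B: "B > 0" "\<And>x. norm (f x) \<le> norm x * B" using pos_bounded by blast
  define p where "p x = (SUP a\<in>{0..pprt x}. f a)" for x
  have upper: "f a \<le> B * norm x" if "a \<in> {0..pprt x}" for a x
  proof -
    have "f a \<le> norm a * B" using B(2)[of a] by simp
    also have "\<dots> \<le> norm x * B"
      using that B(1) norm_le_of_nonneg[of a "pprt x"] norm_pprt_le[of x] by (intro mult_right_mono) auto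
    finally show ?thesis by (simp add: mult.commute)
  qed
  then have bdd: "bdd_above (f ` {0..pprt x})" for x by (intro bdd_aboveI2)
  have p_upper: "f a \<le> p x" if "0 \<le> a" "a \<le> pprt x" for a x
    unfolding p_def using that by (intro cSUP_upper bdd) auto
  have p_least: "p x \<le> c" if "\<And>a. 0 \<le> a \<Longrightarrow> a \<le> pprt x \<Longrightarrow> f a \<le> c" for x c
    unfolding p_def using that by (intro cSUP_least) auto
  have p0: "p x = 0" if "x \<le> 0" for x
    using that by (simp add: p_def zero)
  have p: "sublinear p"
  proof (rule sublinearI)
    fix x y
    show "p (x + y) \<le> p x + p y"
    proof (rule p_least)
      fix a assume a: "0 \<le> a" "a \<le> pprt (x + y)"
      \<comment> \<open>Riesz decomposition of \<open>a\<close>: the excess \<open>a2\<close> over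
        \<open>pprt x\<close> fits below \<open>pprt y\<close>, the rest below
        \<open>pprt x\<close>.\<close>
      define a2 where "a2 = pprt (a - pprt x)"
      have "a - pprt x \<le> pprt y"
        using order_trans[OF a(2) pprt_add_le] by (simp add: algebra_simps)
      then have "0 \<le> a2" "a2 \<le> pprt y" by (auto simp: a2_def pprt_least)
      moreover have "a2 \<le> a" unfolding a2_def using a(1) by (intro pprt_least) auto
      moreover have "a - a2 \<le> pprt x"
        using le_pprt[of "a - pprt x"] by (simp add: a2_def algebra_simps)
      ultimately have "f (a - a2) \<le> p x" "f a2 \<le> p y" by (auto intro: p_upper)
      then show "f a \<le> p x + p y" by (simp add: diff)
    qed
  next
    fix t :: real and x assume t: "t > 0"
    show "p (t *\<^sub>R x) \<le> t * p x"
    proof (rule p_least)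
      fix a assume a: "0 \<le> a" "a \<le> pprt (t *\<^sub>R x)"
      have "inverse t *\<^sub>R a \<le> inverse t *\<^sub>R (t *\<^sub>R pprt x)"
        using a(2) t by (intro scaleR_left_mono) (auto simp: pprt_scaleR)
      then have "f (inverse t *\<^sub>R a) \<le> p x"
        using t a(1) by (intro p_upper scaleR_nonneg_nonneg) auto
      then show "f a \<le> t * p x" using t by (simp add: scaleR field_simps)
    qed
  qed (simp add: p0)
  define A where "A = (\<lambda>z. (z, f z)) ` {0..}"
  have A: "ordering_cone A"
    unfolding A_def by (rule ordering_coneI[of "(0, f 0)"])
      (auto simp: add scaleR intro!: scaleR_nonneg_nonneg image_eqI)
  have "b \<le> p a" if "(a, b) \<in> A" for a b
    using that by (auto simp: A_def intro: p_upper)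
  then obtain g where g: "linear g" "\<And>x. g x \<le> p x" "\<And>a b. (a, b) \<in> A \<Longrightarrow> b \<le> g a"
    using mazur_orlicz[OF p A] by blast
  have "p x \<le> B * norm x" for x using upper by (intro p_least) auto
  then have "g x \<le> B * norm x" for x using g(2) order_trans by blast
  then have "bounded_linear g" using g(1) by (intro bounded_linear_of_le_norm)
  moreover have "0 \<le> g x" if "0 \<le> x" for x
    using g(2)[of "- x"] p0[of "- x"] that g(1) by (simp add: linear_neg)
  ultimately have "g \<in> positive_dual" by (simp add: positive_dual_def)
  moreover have "f x \<le> g x" if "0 \<le> x" for x
    using that by (intro g(3)) (simp add: A_def)
  moreover have "g x \<le> c" if "0 \<le> x" "\<And>a. 0 \<le> a \<Longrightarrow> a \<le> x \<Longrightarrow> f a \<le> c" for x c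
    using that by (intro order_trans[OF g(2) p_least]) auto
  ultimately show ?thesis by (rule that)
qed

text \<open>Take for \<open>\<psi>2\<close> the positive part of \<open>\<psi> - \<xi>\<close>. It
  dominates \<open>\<psi> - \<xi>\<close>, which gives \<open>\<psi>1 \<le> \<xi>\<close>, and as a
  least upper bound it stays below both \<open>\<psi>\<close> and \<open>\<omega>\<close>.\<close>

lemma dual_riesz_decomposition:
  assumes chi: "\<xi> \<in> positive_dual" and omega: "\<omega> \<in> positive_dual"
    and psi: "\<psi> \<in> dual_interval (\<lambda>x. \<xi> x + \<omega> x)"
  obtains \<psi>1 \<psi>2 where "\<psi>1 \<in> dual_interval \<xi>" "\<psi>2 \<in> dual_interval \<omega>" "\<And>x. \<psi> x = \<psi>1 x + \<psi>2 x"
proof -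
  have psi_le: "\<psi> x \<le> \<xi> x + \<omega> x" if "0 \<le> x" for x
    using psi that by (simp add: dual_interval_def)
  have psi_pos: "\<psi> \<in> positive_dual" using psi by (rule dual_interval_imp_positive_dual)
  have bl: "bounded_linear (\<lambda>x. \<psi> x - \<xi> x)"
    using psi_pos chi by (simp add: positive_dual_def bounded_linear_sub)
  obtain g where g: "g \<in> positive_dual" "\<And>x. 0 \<le> x \<Longrightarrow> \<psi> x - \<xi> x \<le> g x"
    "\<And>x c. 0 \<le> x \<Longrightarrow> (\<And>a. 0 \<le> a \<Longrightarrow> a \<le> x \<Longrightarrow> \<psi> a - \<xi> a \<le> c) \<Longrightarrow> g x \<le> c"
    using dual_positive_part[OF bl] by metis
  have "g x \<le> \<psi> x" if "0 \<le> x" for x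
  proof (rule g(3)[OF that])
    fix a assume "0 \<le> a" "a \<le> x"
    then show "\<psi> a - \<xi> a \<le> \<psi> x"
      using positive_dual_mono[OF psi_pos, of a x] positive_dual_nonneg[OF chi, of a] by simp
  qed
  then have "(\<lambda>x. \<psi> x - g x) \<in> dual_interval \<xi>"
    using g(1,2) psi_pos by (force simp: dual_interval_def positive_dual_def bounded_linear_sub algebra_simps)
  moreover have "g x \<le> \<omega> x" if "0 \<le> x" for x
  proof (rule g(3)[OF that])
    fix a assume "0 \<le> a" "a \<le> x"
    then show "\<psi> a - \<xi> a \<le> \<omega> x"
      using positive_dual_mono[OF omega, of a x] psi_le[of a] by simp
  qed
  then have "g \<in> dual_interval \<omega>"
    using g(1) by (simp add: dual_interval_def positive_dual_def)
  ultimately show ?thesis by (rule that) simp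
qed

text \<open>A functional supporting \<open>\<lambda>z. \<xi> (pprt z)\<close> at
  \<open>x - y\<close> plays the role of restricting \<open>\<xi>\<close> to the part where
  \<open>x\<close> exceeds \<open>y\<close>. The splitting transfers bounds that hold for all
  positive functionals from \<open>x\<close> and \<open>y\<close> to \<open>sup x y\<close>.\<close>

lemma positive_dual_sup:
  assumes chi: "\<xi> \<in> positive_dual"
  obtains \<xi>1 \<xi>2 where "\<xi>1 \<in> positive_dual" "\<xi>2 \<in> positive_dual" "\<And>z. \<xi> z = \<xi>1 z + \<xi>2 z"
    "\<xi> (sup x y) = \<xi>1 x + \<xi>2 y"
proof -
  obtain f where f: "linear f" "\<And>z. f z \<le> \<xi> (pprt z)" "f (x - y) = \<xi> (pprt (x - y))"
    using linear_le_sublinear_attained[OF sublinear_positive_dual_pprt[OF chi]] by metis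
  have fi: "f \<in> dual_interval \<xi>" using chi f(1,2) by (rule dual_intervalI_pprt)
  show ?thesis
  proof
    show "f \<in> positive_dual" "(\<lambda>z. \<xi> z - f z) \<in> positive_dual"
      using fi dual_interval_diff[OF chi fi] by (auto intro: dual_interval_imp_positive_dual)
    show "\<xi> (sup x y) = f x + (\<xi> y - f y)"
      using f(1,3) positive_dual_linear[OF chi] by (simp add: sup_eq_pprt linear_add linear_diff)
  qed simp
qed

section \<open>Suprema, carriers and absolute continuity in KB-spaces\<close>

lemma kb_space_directed_sup:
  fixes S :: "'b::banach_lattice set"
  assumes kb: "kb_space TYPE('b)" and ne: "S \<noteq> {}" and dir: "\<And>x y. x \<in> S \<Longrightarrow> y \<in> S \<Longrightarrow> sup x y \<in> S"
    and bdd: "\<And>x. x \<in> S \<Longrightarrow> norm x \<le> M"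
  obtains s u where "\<And>x. x \<in> S \<Longrightarrow> x \<le> s" "\<And>n. u n \<in> S" "u \<longlonglongrightarrow> s"
proof -
  have conv: "convergent v" if "\<And>n. v n \<in> S" "incseq v" for v :: "nat \<Rightarrow> 'b"
    using kb that bdd unfolding kb_space_def by (metis BseqI')
  \<comment> \<open>Otherwise \<open>S\<close> would contain an increasing sequence with all steps
    longer than \<open>\<epsilon>\<close>, which cannot converge.\<close>
  have almost_max: "\<exists>x\<in>S. x0 \<le> x \<and> (\<forall>y\<in>S. x \<le> y \<longrightarrow> norm (y - x) \<le> \<epsilon>)"
    if x0: "x0 \<in> S" and eps: "\<epsilon> > 0" for x0 \<epsilon>
  proof (rule ccontr)
    assume "\<not> ?thesis"
    then have "\<forall>x. x \<in> S \<and> x0 \<le> x \<longrightarrow> (\<exists>y. y \<in> S \<and> x \<le> y \<and> norm (y - x) > \<epsilon>)" by force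
    then obtain c where c: "\<And>x. x \<in> S \<Longrightarrow> x0 \<le> x \<Longrightarrow> c x \<in> S \<and> x \<le> c x \<and> norm (c x - x) > \<epsilon>"
      by metis
    define v where "v n = (c ^^ n) x0" for n
    have v: "v n \<in> S \<and> x0 \<le> v n" for n
      by (induction n) (use x0 c in \<open>auto simp: v_def intro: order_trans\<close>)
    have step: "v n \<le> v (Suc n)" "norm (v (Suc n) - v n) > \<epsilon>" for n
      using c[of "v n"] v[of n] by (auto simp: v_def)
    have "convergent v" using v step(1) by (intro conv incseq_SucI) auto
    then obtain l where l: "v \<longlonglongrightarrow> l" by (auto simp: convergent_def)
    then have "(\<lambda>n. v (Suc n) - v n) \<longlonglongrightarrow> l - l" by (intro tendsto_diff LIMSEQ_Suc)
    then have "(\<lambda>n. norm (v (Suc n) - v n)) \<longlonglongrightarrow> 0" using tendsto_norm_zero by fastforce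
    then have "\<epsilon> \<le> 0" using step(2) by (intro LIMSEQ_le_const) (auto intro: less_imp_le)
    with eps show False by simp
  qed
  obtain x0 where x0: "x0 \<in> S" using ne by auto
  have "\<exists>u. \<forall>n. (u n \<in> S \<and> (\<forall>y\<in>S. u n \<le> y \<longrightarrow> norm (y - u n) \<le> inverse (real (Suc n)))) \<and> u n \<le> u (Suc n)"
  proof (rule dependent_nat_choice)
    show "\<exists>x. x \<in> S \<and> (\<forall>y\<in>S. x \<le> y \<longrightarrow> norm (y - x) \<le> inverse (real (Suc 0)))"
      using almost_max[OF x0, of "inverse (real (Suc 0))"] by auto
    show "\<exists>y. (y \<in> S \<and> (\<forall>ya\<in>S. y \<le> ya \<longrightarrow> norm (ya - y) \<le> inverse (real (Suc (Suc n))))) \<and> x \<le> y"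
      if "x \<in> S \<and> (\<forall>y\<in>S. x \<le> y \<longrightarrow> norm (y - x) \<le> inverse (real (Suc n)))" for x n
      using almost_max[of x "inverse (real (Suc (Suc n)))"] that by auto
  qed
  then obtain u where u: "\<And>n. u n \<in> S" "\<And>n. u n \<le> u (Suc n)"
    "\<And>n y. y \<in> S \<Longrightarrow> u n \<le> y \<Longrightarrow> norm (y - u n) \<le> inverse (real (Suc n))" by metis
  obtain s where s: "u \<longlonglongrightarrow> s"
  proof -
    have "incseq u" by (rule incseq_SucI) (rule u(2))
    then have "convergent u" using u(1) by (intro conv)
    then show ?thesis using that by (auto simp: convergent_def)
  qed
  have "x \<le> s" if x: "x \<in> S" for x
  proof -
    \<comment> \<open>\<open>pprt (x - u n)\<close> equals \<open>sup x (u n) - u n\<close>, a step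
      inside \<open>S\<close> upwards from the almost maximal \<open>u n\<close>.\<close>
    have bound: "norm (pprt (x - u n)) \<le> inverse (real (Suc n))" for n
      using u(3)[OF dir[OF x u(1)], of n n] by (simp add: sup_eq_pprt)
    have "(\<lambda>n. pprt (x - u n)) \<longlonglongrightarrow> 0"
      by (rule Lim_null_comparison[OF _ LIMSEQ_inverse_real_of_nat]) (use bound in auto)
    moreover have "(\<lambda>n. pprt (x - u n)) \<longlonglongrightarrow> pprt (x - s)"
      by (intro tendsto_pprt tendsto_intros s)
    ultimately have "pprt (x - s) = 0" using LIMSEQ_unique by blast
    then show ?thesis by (simp add: le_zero_iff_zero_pprt[symmetric])
  qed
  then show ?thesis using u(1) s by (rule that)
qed

lemma positive_dual_tendsto: "\<phi> \<in> positive_dual \<Longrightarrow> u \<longlonglongrightarrow> s \<Longrightarrow> (\<lambda>n. \<phi> (u n)) \<longlonglongrightarrow> \<phi> s"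
  by (simp add: positive_dual_def bounded_linear.tendsto)

text \<open>Let \<open>s\<close> be the supremum of the null vectors of \<open>\<phi>\<close> below
  \<open>e\<close>; it is null itself, being a norm limit of them. Then \<open>e - s\<close> works:
  a null vector \<open>a\<close> below it would make \<open>s + a\<close> a null vector below
  \<open>e\<close>, hence \<open>s + a \<le> s\<close>.\<close>

lemma kb_space_carrier:
  fixes e :: "'b::banach_lattice"
  assumes kb: "kb_space TYPE('b)" and phi: "\<phi> \<in> positive_dual" and e: "0 \<le> e" "0 < \<phi> e"
  obtains x where "0 \<le> x" "x \<le> e" "x \<noteq> 0" "\<And>a. 0 \<le> a \<Longrightarrow> a \<le> x \<Longrightarrow> \<phi> a = 0 \<Longrightarrow> a = 0"
proof -
  note lin = positive_dual_linear[OF phi]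
  define S where "S = {a. 0 \<le> a \<and> a \<le> e \<and> \<phi> a = 0}"
  have sup_le: "sup a b \<le> a + b" if "0 \<le> a" "0 \<le> b" for a b :: 'b
    using that by simp
  have "S \<noteq> {}" using e linear_0[OF lin] by (auto simp: S_def)
  moreover have "sup a b \<in> S" if "a \<in> S" "b \<in> S" for a b
  proof -
    have "\<phi> (sup a b) \<le> \<phi> (a + b)"
      using that by (intro positive_dual_mono[OF phi] sup_le) (auto simp: S_def)
    also have "\<dots> = 0" using that by (simp add: linear_add[OF lin] S_def)
    finally have "\<phi> (sup a b) \<le> 0" .
    moreover have "0 \<le> sup a b" using that by (auto simp: S_def intro: le_supI1)
    ultimately show ?thesis
      using that positive_dual_nonneg[OF phi, of "sup a b"] by (simp add: S_def)
  qed
  moreover have "norm a \<le> norm e" if "a \<in> S" for a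
    using that by (intro norm_le_of_nonneg) (auto simp: S_def)
  ultimately obtain s u where s: "\<And>a. a \<in> S \<Longrightarrow> a \<le> s" "\<And>n. u n \<in> S" "u \<longlonglongrightarrow> s"
    using kb_space_directed_sup[OF kb] by metis
  have "(\<lambda>n. \<phi> (u n)) \<longlonglongrightarrow> \<phi> s" using phi s(3) by (rule positive_dual_tendsto)
  then have phis: "\<phi> s = 0" using s(2) by (simp add: S_def LIMSEQ_const_iff)
  have s0: "0 \<le> s" using s(1)[of 0] e linear_0[OF lin] by (simp add: S_def)
  have se: "s \<le> e" using s(2) by (intro lattice_LIMSEQ_le_const2[OF s(3), of 0]) (auto simp: S_def)
  show ?thesis
  proof
    show "0 \<le> e - s" "e - s \<le> e" using s0 se by auto
    show "e - s \<noteq> 0" using phis e by auto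
    fix a assume a: "0 \<le> a" "a \<le> e - s" "\<phi> a = 0"
    then have "s + a \<in> S"
      using s0 phis by (auto simp: S_def linear_add[OF lin] algebra_simps)
    then have "s + a \<le> s" by (rule s(1))
    then show "a = 0" using a(1) by simp
  qed
qed

text \<open>Strict positivity upgrades to absolute continuity: a sequence \<open>a\<close> violating it with
  \<open>\<phi> (a n) < (1/2)^n\<close> would have a nonzero limit superior annihilated by \<open>\<phi>\<close>.\<close>

lemma kb_space_absolute_continuity:
  fixes x :: "'b::banach_lattice"
  assumes kb: "kb_space TYPE('b)" and phi: "\<phi> \<in> positive_dual" and chi: "\<xi> \<in> positive_dual"
    and strict: "\<And>a. 0 \<le> a \<Longrightarrow> a \<le> x \<Longrightarrow> \<phi> a = 0 \<Longrightarrow> a = 0" and eps: "\<epsilon> > 0"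
  obtains \<delta> where "\<delta> > 0" "\<And>a. 0 \<le> a \<Longrightarrow> a \<le> x \<Longrightarrow> \<phi> a < \<delta> \<Longrightarrow> \<xi> a < \<epsilon>"
proof -
  have "\<exists>\<delta>>0. \<forall>a. 0 \<le> a \<and> a \<le> x \<and> \<phi> a < \<delta> \<longrightarrow> \<xi> a < \<epsilon>"
  proof (rule ccontr)
    assume "\<not> ?thesis"
    then have "\<exists>a. 0 \<le> a \<and> a \<le> x \<and> \<phi> a < (1/2) ^ n \<and> \<epsilon> \<le> \<xi> a" for n :: nat
      by (metis not_less zero_less_power half_gt_zero zero_less_one)
    then obtain a where a: "\<And>n. 0 \<le> a n" "\<And>n. a n \<le> x" "\<And>n. \<phi> (a n) < (1/2) ^ n" "\<And>n. \<epsilon> \<le> \<xi> (a n)"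
      by metis
    \<comment> \<open>\<open>c n m\<close> is the supremum of \<open>a n, ..., a (n + m)\<close>.
      Its limit \<open>b n\<close> in \<open>m\<close> is the tail supremum, and the limit
      \<open>l\<close> of \<open>b\<close> is the limit superior. These are norm limits by the KB
      property, so functionals pass to them.\<close>
    define c where "c n m = rec_nat (a n) (\<lambda>m r. sup r (a (n + Suc m))) m" for n m
    have c0: "c n 0 = a n" and cS: "c n (Suc m) = sup (c n m) (a (n + Suc m))" for n m
      by (auto simp: c_def)
    have c_nonneg: "0 \<le> c n m" for n m
      by (induction m) (use a in \<open>auto simp: c0 cS intro: le_supI1\<close>)
    have c_le: "c n m \<le> x" for n m
      by (induction m) (use a in \<open>auto simp: c0 cS\<close>)
    have c_inc: "incseq (c n)" for n
      by (rule incseq_SucI) (simp add: cS)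
    have c_dec: "c (Suc n) m \<le> c n (Suc m)" for n m
    proof (induction m)
      case (Suc m)
      then have "c (Suc n) m \<le> c n (Suc (Suc m))" using cS[of n "Suc m"] by (auto intro: le_supI1)
      then show ?case using cS[of "Suc n" m] cS[of n "Suc m"] by simp
    qed (simp add: c0 cS)
    \<comment> \<open>The right-hand side is the geometric sum of \<open>(1/2) ^ j\<close> for
      \<open>j\<close> from \<open>n\<close> to \<open>n + m\<close>.\<close>
    have phi_c: "\<phi> (c n m) \<le> 2 * (1/2) ^ n - (1/2) ^ (n + m)" for n m
    proof (induction m)
      case 0
      then show ?case using a(3)[of n] by (simp add: c0)
    next
      case (Suc m)
      have "\<phi> (c n (Suc m)) \<le> \<phi> (c n m + a (n + Suc m))"
        unfolding cS using a(1) c_nonneg by (intro positive_dual_mono[OF phi]) auto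
      also have "\<dots> = \<phi> (c n m) + \<phi> (a (n + Suc m))"
        by (rule linear_add[OF positive_dual_linear[OF phi]])
      also have "\<dots> \<le> 2 * (1/2) ^ n - (1/2) ^ (n + m) + (1/2) ^ (n + Suc m)"
        using Suc a(3)[of "n + Suc m"] by linarith
      finally show ?case by simp
    qed
    have c_bdd: "Bseq (c n)" for n
      using norm_le_of_nonneg[OF c_nonneg c_le] by (intro BseqI'[of _ "norm x"]) auto
    then have "\<exists>b. c n \<longlonglongrightarrow> b" for n
      using kb c_inc unfolding kb_space_def convergent_def by blast
    then obtain b where b: "\<And>n. c n \<longlonglongrightarrow> b n" by metis
    have b_nonneg: "0 \<le> b n" for n using b c_nonneg by (rule lattice_LIMSEQ_le_const)
    have b_le: "b n \<le> x" for n using b c_le by (rule lattice_LIMSEQ_le_const2)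
    have c_le_b: "c n m \<le> b n" for n m
      using b by (rule lattice_LIMSEQ_le_const[of _ _ m]) (use c_inc in \<open>auto simp: incseq_def\<close>)
    have "b (Suc n) \<le> b n" for n
      using b by (rule lattice_LIMSEQ_le_const2) (use c_dec c_le_b order_trans in blast)
    then have "incseq (\<lambda>n. - b n)" by (intro incseq_SucI) simp
    moreover have "Bseq (\<lambda>n. - b n)"
      using norm_le_of_nonneg[OF b_nonneg b_le] by (intro BseqI'[of _ "norm x"]) auto
    ultimately have "convergent (\<lambda>n. - b n)" using kb unfolding kb_space_def by blast
    then obtain l where l: "b \<longlonglongrightarrow> l" unfolding convergent_minus_iff[symmetric] convergent_def by blast
    have "\<phi> (b n) \<le> 2 * (1/2) ^ n" for n
    proof (rule LIMSEQ_le_const2[OF positive_dual_tendsto[OF phi b]])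
      have "\<phi> (c n m) \<le> 2 * (1/2) ^ n" for m
        using phi_c[of n m] by (smt (verit) zero_less_power half_gt_zero)
      then show "\<exists>N. \<forall>m\<ge>N. \<phi> (c n m) \<le> 2 * (1/2) ^ n" by blast
    qed
    moreover have "(\<lambda>n. 2 * (1/2 :: real) ^ n) \<longlonglongrightarrow> 0"
      by (intro tendsto_mult_right_zero LIMSEQ_power_zero) simp
    ultimately have "\<phi> l \<le> 0"
      using LIMSEQ_le[OF positive_dual_tendsto[OF phi l]] by blast
    moreover have "0 \<le> l" using l b_nonneg by (rule lattice_LIMSEQ_le_const)
    moreover have "l \<le> x" using l b_le by (rule lattice_LIMSEQ_le_const2)
    ultimately have "l = 0" using strict positive_dual_nonneg[OF phi, of l] by force
    then have "(\<lambda>n. \<xi> (b n)) \<longlonglongrightarrow> 0"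
      using positive_dual_tendsto[OF chi l] linear_0[OF positive_dual_linear[OF chi]] by simp
    moreover have "\<epsilon> \<le> \<xi> (b n)" for n
      using a(4)[of n] positive_dual_mono[OF chi c_le_b[of n 0]] by (simp add: c0)
    ultimately have "\<epsilon> \<le> 0" by (intro LIMSEQ_le_const) auto
    with eps show False by simp
  qed
  then show ?thesis using that by blast
qed

text \<open>With \<open>g\<close> the positive part of \<open>\<xi> - n * \<phi>\<close>, the
  difference \<open>\<xi> - g\<close> is the infimum of \<open>\<xi>\<close> and
  \<open>n * \<phi>\<close> in the dual. Absolute continuity says that below \<open>x\<close>
  nothing of \<open>\<xi>\<close> is singular to \<open>\<phi>\<close>, so these truncations exhaust
  \<open>\<xi>\<close> at \<open>x\<close>.\<close>

lemma kb_space_dual_truncation: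
  fixes x :: "'b::banach_lattice"
  assumes kb: "kb_space TYPE('b)" and phi: "\<phi> \<in> positive_dual" and chi: "\<xi> \<in> positive_dual"
    and x: "0 \<le> x" and strict: "\<And>a. 0 \<le> a \<Longrightarrow> a \<le> x \<Longrightarrow> \<phi> a = 0 \<Longrightarrow> a = 0" and eps: "\<epsilon> > 0"
  obtains \<psi> n where "\<psi> \<in> dual_interval \<xi>" "\<psi> \<in> dual_interval (\<lambda>y. real n * \<phi> y)" "\<xi> x \<le> \<psi> x + \<epsilon>"
proof -
  obtain \<delta> where delta: "\<delta> > 0" "\<And>a. 0 \<le> a \<Longrightarrow> a \<le> x \<Longrightarrow> \<phi> a < \<delta> \<Longrightarrow> \<xi> a < \<epsilon>"
    using kb_space_absolute_continuity[OF kb phi chi strict eps] by metis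
  \<comment> \<open>Chosen so that \<open>n * \<phi> a\<close> is at least \<open>\<xi> x\<close> as
    soon as \<open>\<phi> a \<ge> \<delta>\<close>; for smaller \<open>\<phi> a\<close> absolute
    continuity takes over.\<close>
  obtain n :: nat where n: "\<xi> x / \<delta> \<le> real n" using real_arch_simple by blast
  have bl: "bounded_linear (\<lambda>y. \<xi> y - real n * \<phi> y)"
    using phi chi by (simp add: positive_dual_def bounded_linear_sub bounded_linear_const_mult)
  obtain g where g: "g \<in> positive_dual" "\<And>y. 0 \<le> y \<Longrightarrow> \<xi> y - real n * \<phi> y \<le> g y"
    "\<And>y c. 0 \<le> y \<Longrightarrow> (\<And>a. 0 \<le> a \<Longrightarrow> a \<le> y \<Longrightarrow> \<xi> a - real n * \<phi> a \<le> c) \<Longrightarrow> g y \<le> c"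
    using dual_positive_part[OF bl] by metis
  have g_le: "g y \<le> \<xi> y" if "0 \<le> y" for y
  proof (rule g(3)[OF that])
    fix a assume a: "0 \<le> a" "a \<le> y"
    have "0 \<le> real n * \<phi> a" using positive_dual_nonneg[OF phi a(1)] by simp
    then show "\<xi> a - real n * \<phi> a \<le> \<xi> y"
      using positive_dual_mono[OF chi a(2)] by linarith
  qed
  have gi: "g \<in> dual_interval \<xi>" using g(1) g_le by (simp add: dual_interval_def positive_dual_def)
  have "g x \<le> \<epsilon>"
  proof (rule g(3)[OF x])
    fix a assume a: "0 \<le> a" "a \<le> x"
    show "\<xi> a - real n * \<phi> a \<le> \<epsilon>"
    proof (cases "\<phi> a < \<delta>")
      case True
      have "0 \<le> real n * \<phi> a" using positive_dual_nonneg[OF phi a(1)] by simp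
      with delta(2)[OF a True] show ?thesis by linarith
    next
      case False
      have "\<xi> a \<le> \<xi> x" by (rule positive_dual_mono[OF chi a(2)])
      also have "\<dots> \<le> real n * \<delta>" using n delta(1) by (simp add: field_simps)
      also have "\<dots> \<le> real n * \<phi> a" using False by (intro mult_left_mono) auto
      finally show ?thesis using eps by simp
    qed
  qed
  show ?thesis
  proof
    show psi: "(\<lambda>y. \<xi> y - g y) \<in> dual_interval \<xi>" using chi gi by (rule dual_interval_diff)
    show "(\<lambda>y. \<xi> y - g y) \<in> dual_interval (\<lambda>y. real n * \<phi> y)"
      using psi g(2) by (force simp: dual_interval_def algebra_simps)
    show "\<xi> x \<le> \<xi> x - g x + \<epsilon>" using \<open>g x \<le> \<epsilon>\<close> by simp
  qed
qed

text \<open>Hahn decomposition, by exhaustion: repeatedly remove from \<open>\<phi>\<close> a part that is at least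
  half as negative as possible.\<close>

lemma dual_hahn_decomposition:
  fixes T :: "('b::banach_lattice \<Rightarrow> real) \<Rightarrow> real"
  assumes phi: "\<phi> \<in> positive_dual" and e: "0 \<le> e"
    and add: "\<And>\<xi> \<omega>. \<xi> \<in> positive_dual \<Longrightarrow> \<omega> \<in> positive_dual \<Longrightarrow> T (\<lambda>x. \<xi> x + \<omega> x) = T \<xi> + T \<omega>"
    and cont: "\<And>\<epsilon>. \<epsilon> > 0 \<Longrightarrow> \<exists>\<delta>>0. \<forall>\<xi>\<in>dual_interval \<phi>. \<xi> e < \<delta> \<longrightarrow> \<bar>T \<xi>\<bar> \<le> \<epsilon>"
    and lower: "\<And>\<xi>. \<xi> \<in> dual_interval \<phi> \<Longrightarrow> - B \<le> T \<xi>"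
  obtains \<phi>' where "\<phi>' \<in> dual_interval \<phi>" "T \<phi> \<le> T \<phi>'" "\<And>\<xi>. \<xi> \<in> dual_interval \<phi>' \<Longrightarrow> 0 \<le> T \<xi>"
proof -
  have T_diff: "T (\<lambda>x. \<omega> x - \<xi> x) = T \<omega> - T \<xi>" if "\<omega> \<in> positive_dual" "\<xi> \<in> dual_interval \<omega>" for \<omega> \<xi>
    using add[of "\<lambda>x. \<omega> x - \<xi> x" \<xi>] dual_interval_diff[OF that] that(2)
    by (simp add: dual_interval_imp_positive_dual)
  have T0: "T (\<lambda>_. 0) = 0"
    using add[of "\<lambda>_. 0" "\<lambda>_. 0"] by (simp add: positive_dual_def)
  \<comment> \<open>If the infimum \<open>t\<close> is negative, some functional gets below
    \<open>t / 2\<close>; if it is \<open>0\<close>, the zero functional is taken.\<close>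
  have step: "\<exists>\<xi>. \<xi> \<in> dual_interval \<omega> \<and> T \<xi> \<le> 0 \<and> (\<forall>\<xi>'\<in>dual_interval \<omega>. 2 * T \<xi> \<le> T \<xi>')"
    if omega: "\<omega> \<in> dual_interval \<phi>" for \<omega>
  proof -
    let ?I = "dual_interval \<omega>"
    define t where "t = (INF \<xi>\<in>?I. T \<xi>)"
    have zero: "(\<lambda>_. 0) \<in> ?I"
      using omega by (intro zero_in_dual_interval) (rule dual_interval_imp_positive_dual)
    have bdd: "bdd_below (T ` ?I)"
      using lower dual_interval_trans[OF _ omega] by (intro bdd_belowI2[of _ "- B"]) auto
    have t_le: "t \<le> T \<xi>" if "\<xi> \<in> ?I" for \<xi>
      unfolding t_def using bdd that by (rule cINF_lower)
    show ?thesis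
    proof (cases "t = 0")
      case True
      with zero T0 t_le show ?thesis by (intro exI[of _ "\<lambda>_. 0"]) auto
    next
      case False
      then have "t < t / 2" using t_le[OF zero] T0 by simp
      then obtain \<xi> where "\<xi> \<in> ?I" "T \<xi> < t / 2"
        unfolding t_def using cINF_less_iff[OF _ bdd] zero by blast
      with t_le \<open>t < t / 2\<close> show ?thesis by (intro exI[of _ \<xi>]) force
    qed
  qed
  then obtain c where c: "\<And>\<omega>. \<omega> \<in> dual_interval \<phi> \<Longrightarrow> c \<omega> \<in> dual_interval \<omega>"
    "\<And>\<omega>. \<omega> \<in> dual_interval \<phi> \<Longrightarrow> T (c \<omega>) \<le> 0"
    "\<And>\<omega> \<xi>. \<omega> \<in> dual_interval \<phi> \<Longrightarrow> \<xi> \<in> dual_interval \<omega> \<Longrightarrow> 2 * T (c \<omega>) \<le> T \<xi>"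
    by metis
  define \<Phi> where "\<Phi> n = ((\<lambda>\<omega> x. \<omega> x - c \<omega> x) ^^ n) \<phi>" for n
  have Phi_0: "\<Phi> 0 = \<phi>" and Phi_Suc: "\<Phi> (Suc n) = (\<lambda>x. \<Phi> n x - c (\<Phi> n) x)" for n
    by (auto simp: \<Phi>_def)
  have Phi: "\<Phi> n \<in> dual_interval \<phi>" for n
  proof (induction n)
    case (Suc n)
    then have "\<Phi> (Suc n) \<in> dual_interval (\<Phi> n)"
      unfolding Phi_Suc by (intro dual_interval_diff c(1) dual_interval_imp_positive_dual)
    then show ?case using Suc dual_interval_trans by blast
  qed (simp add: Phi_0 self_in_dual_interval phi)
  have Phi_pos: "\<Phi> n \<in> positive_dual" for n using Phi by (rule dual_interval_imp_positive_dual)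
  have Phi_dec: "\<Phi> m x \<le> \<Phi> n x" if "n \<le> m" "0 \<le> x" for m n x
  proof (rule lift_Suc_antimono_le[of "\<lambda>k. \<Phi> k x", OF _ that(1)])
    show "\<Phi> (Suc k) x \<le> \<Phi> k x" for k
      using c(1)[OF Phi[of k]] that(2) by (simp add: Phi_Suc dual_interval_def)
  qed
  have T_Suc: "T (\<Phi> (Suc n)) = T (\<Phi> n) - T (c (\<Phi> n))" for n
    unfolding Phi_Suc using Phi_pos c(1)[OF Phi] by (rule T_diff)
  have T_inc: "incseq (\<lambda>n. T (\<Phi> n))"
    using c(2)[OF Phi] by (intro incseq_SucI) (simp add: T_Suc)
  have "T (\<Phi> n) \<le> T \<phi> + B" for n
    using lower[OF dual_interval_diff[OF phi Phi[of n]]] T_diff[OF phi Phi, of n] by simp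
  then obtain L where L: "(\<lambda>n. T (\<Phi> n)) \<longlonglongrightarrow> L" using T_inc incseq_convergent by blast
  then have "(\<lambda>n. T (\<Phi> n) - T (\<Phi> (Suc n))) \<longlonglongrightarrow> L - L"
    by (intro tendsto_diff LIMSEQ_Suc)
  \<comment> \<open>What is removed vanishes in the limit, so by the factor \<open>2\<close> in the
    choice of \<open>c\<close> no functional below every \<open>\<Phi> n\<close> has a negative
    \<open>T\<close>.\<close>
  then have Tc: "(\<lambda>n. T (c (\<Phi> n))) \<longlonglongrightarrow> 0" by (simp add: T_Suc)
  obtain f where f: "f \<in> dual_interval \<phi>"
    "\<And>a b. \<forall>\<^sub>F j in sequentially. b \<le> \<Phi> j a \<Longrightarrow> b \<le> f a"
    "\<And>a b. \<forall>\<^sub>F j in sequentially. \<Phi> j a \<le> b \<Longrightarrow> f a \<le> b"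
    using dual_interval_cluster[OF phi, of \<Phi>] Phi by metis
  have f_Phi: "f \<in> dual_interval (\<Phi> n)" for n
  proof -
    have "f x \<le> \<Phi> n x" if "0 \<le> x" for x
      using Phi_dec[of n _ x] that by (intro f(3) eventually_sequentiallyI[of n])
    then show ?thesis using f(1) by (simp add: dual_interval_def)
  qed
  have "decseq (\<lambda>n. \<Phi> n e)" using Phi_dec e by (simp add: decseq_def)
  moreover have "0 \<le> \<Phi> n e" for n using Phi_pos e by (rule positive_dual_nonneg)
  ultimately obtain L' where L': "(\<lambda>n. \<Phi> n e) \<longlonglongrightarrow> L'" "\<And>n. L' \<le> \<Phi> n e"
    using decseq_convergent[of "\<lambda>n. \<Phi> n e" 0] by metis
  have "L' \<le> f e" using L'(2) by (intro f(2)) simp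
  \<comment> \<open>\<open>T\<close> reaches the limit functional only through \<open>cont\<close>:
    \<open>\<Phi> n - f\<close> is small at \<open>e\<close>, because \<open>\<Phi> n e\<close>
    tends to a value that is at most \<open>f e\<close>.\<close>
  have "T \<phi> \<le> T f + \<epsilon>" if eps: "\<epsilon> > 0" for \<epsilon>
  proof -
    obtain \<delta> where delta: "\<delta> > 0" "\<And>\<xi>. \<xi> \<in> dual_interval \<phi> \<Longrightarrow> \<xi> e < \<delta> \<Longrightarrow> \<bar>T \<xi>\<bar> \<le> \<epsilon>"
      using cont[OF eps] by blast
    have "\<forall>\<^sub>F n in sequentially. \<Phi> n e < L' + \<delta>"
      using L'(1) delta(1) by (intro order_tendstoD) auto
    then obtain n where n: "\<Phi> n e < L' + \<delta>" by (auto simp: eventually_sequentially)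
    have d: "(\<lambda>x. \<Phi> n x - f x) \<in> dual_interval \<phi>"
      using dual_interval_diff[OF Phi_pos f_Phi] Phi by (rule dual_interval_trans)
    have "\<bar>T (\<lambda>x. \<Phi> n x - f x)\<bar> \<le> \<epsilon>"
      using delta(2)[OF d] n \<open>L' \<le> f e\<close> by simp
    then have "T (\<Phi> n) \<le> T f + \<epsilon>" using T_diff[OF Phi_pos f_Phi, of n] by simp
    moreover have "T (\<Phi> 0) \<le> T (\<Phi> n)" using T_inc by (simp add: incseq_def)
    ultimately show ?thesis by (simp add: Phi_0)
  qed
  then have "T \<phi> \<le> T f" by (rule field_le_epsilon)
  moreover have "0 \<le> T \<xi>" if "\<xi> \<in> dual_interval f" for \<xi>
  proof -
    have "(\<lambda>n. 2 * T (c (\<Phi> n))) \<longlonglongrightarrow> 2 * 0" by (intro tendsto_intros Tc)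
    moreover have "2 * T (c (\<Phi> n)) \<le> T \<xi>" for n
      using c(3)[OF Phi dual_interval_trans[OF that f_Phi]] .
    ultimately show ?thesis using LIMSEQ_le_const2 by fastforce
  qed
  ultimately show ?thesis using f(1) that by blast
qed

section \<open>Weak sequential completeness of KB-spaces\<close>

text \<open>Uniform boundedness, by Baire's theorem in the complete space
  \<open>'b \<Rightarrow>\<^sub>L real\<close>: the closed sets of functionals bounded by
  \<open>n\<close> along \<open>u\<close> cover the dual.\<close>

lemma weakly_Cauchy_bounded:
  fixes u :: "nat \<Rightarrow> 'b::real_normed_vector"
  assumes "weakly_Cauchy u"
  shows "\<exists>M. \<forall>n. norm (u n) \<le> M"
proof -
  define E where "E n = {f :: 'b \<Rightarrow>\<^sub>L real. \<forall>k. \<bar>blinfun_apply f (u k)\<bar> \<le> real n}" for n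
  have closed: "closed (E n)" for n
  proof -
    have "E n = (\<Inter>k. {f. \<bar>blinfun_apply f (u k)\<bar> \<le> real n})" by (auto simp: E_def)
    also have "closed \<dots>" by (intro closed_INT ballI closed_Collect_le continuous_intros)
    finally show ?thesis .
  qed
  have UN: "(\<Union>n. E n) = UNIV"
  proof -
    have "\<exists>n. f \<in> E n" for f
    proof -
      have "Cauchy (\<lambda>k. blinfun_apply f (u k))"
        using assms blinfun.bounded_linear_right unfolding weakly_Cauchy_def by blast
      then obtain B where "\<And>k. norm (blinfun_apply f (u k)) \<le> B"
        using Cauchy_Bseq Bseq_def by metis
      moreover obtain n where "B \<le> real n" using real_arch_simple by blast
      ultimately show ?thesis unfolding E_def by (auto intro: order_trans)
    qed
    then show ?thesis by blast
  qed
  have "\<exists>n. interior (E n) \<noteq> {}"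
  proof (rule ccontr)
    assume "\<not> ?thesis"
    then have "Met_TC.mtopology interior_of \<Union>(range E) = {}"
      by (intro Met_TC.metric_Baire_category_alt) (use closed complete_UNIV in auto)
    then show False using UN by simp
  qed
  then obtain n f0 where "f0 \<in> interior (E n)" by auto
  then obtain r where r: "r > 0" "ball f0 r \<subseteq> E n" by (meson mem_interior)
  \<comment> \<open>For a norming functional \<open>f\<close> of \<open>u k\<close>, both
    \<open>f0\<close> and \<open>f0 + (r / 2) *\<^sub>R Blinfun f\<close> lie in \<open>E n\<close>,
    so \<open>(r / 2) * f (u k)\<close> is at most \<open>2 * real n\<close>.\<close>
  have "norm (u k) \<le> 4 * real n / r" for k
  proof -
    obtain f where f: "linear f" "\<And>x. f x \<le> 1 * norm x" "f (u k) = 1 * norm (u k)"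
      using linear_le_sublinear_attained[OF sublinear_norm[of 1]] by auto
    then have bl: "bounded_linear f" by (intro bounded_linear_of_le_norm)
    have "\<bar>f x\<bar> \<le> 1 * norm x" for x
      using f(2)[of x] f(2)[of "- x"] f(1) by (simp add: linear_neg)
    then have "norm (Blinfun f) \<le> 1"
      by (intro norm_blinfun_bound) (auto simp: bounded_linear_Blinfun_apply[OF bl])
    then have "norm ((r / 2) *\<^sub>R Blinfun f) < r" using r(1) by simp
    then have "f0 + (r / 2) *\<^sub>R Blinfun f \<in> E n" "f0 \<in> E n"
      using r by (auto simp: dist_norm subset_iff)
    then have "\<bar>f0 (u k) + (r / 2) * f (u k)\<bar> \<le> real n" "\<bar>f0 (u k)\<bar> \<le> real n"
      by (auto simp: E_def blinfun.add_left blinfun.scaleR_left bounded_linear_Blinfun_apply[OF bl])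
    then have "(r / 2) * norm (u k) \<le> 2 * real n" using f(3) by simp
    then show ?thesis using r(1) by (simp add: field_simps)
  qed
  then show ?thesis by blast
qed

section \<open>Equicontinuity of order intervals along a weakly Cauchy sequence\<close>

lemma positive_dual_abs_le:
  assumes phi: "\<phi> \<in> positive_dual" and le: "\<bar>y\<bar> \<le> z"
  shows "\<bar>\<phi> y\<bar> \<le> \<phi> z"
proof -
  have "\<phi> y \<le> \<phi> z" using le by (intro positive_dual_mono[OF phi]) (metis abs_ge_self order_trans)
  moreover have "\<phi> (- y) \<le> \<phi> z"
    using le by (intro positive_dual_mono[OF phi]) (metis abs_ge_minus_self order_trans)
  ultimately show ?thesis using linear_neg[OF positive_dual_linear[OF phi]] by fastforce
qed

lemma positive_dual_abs_le_scale:
  assumes "\<phi> \<in> positive_dual" "\<bar>y\<bar> \<le> r *\<^sub>R e"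
  shows "\<bar>\<phi> y\<bar> \<le> r * \<phi> e"
  using positive_dual_abs_le[OF assms] linear_scale[OF positive_dual_linear[OF assms(1)]] by simp

text \<open>Adding all of \<open>\<xi>\<close> to \<open>\<psi>\<close> could leave the interval.
  Splitting \<open>\<xi>\<close> along \<open>(\<phi> - \<psi>) + \<psi>\<close> separates a part
  for which there is room above \<open>\<psi>\<close> from a part that can be taken away from
  \<open>\<psi>\<close>.\<close>

lemma dual_interval_shift:
  assumes phi: "\<phi> \<in> positive_dual" and psi: "\<psi> \<in> dual_interval \<phi>" and xi: "\<xi> \<in> dual_interval \<phi>"
  shows "\<exists>\<xi>1\<in>positive_dual. \<exists>\<xi>2\<in>positive_dual. (\<forall>x. \<xi> x = \<xi>1 x + \<xi>2 x) \<and>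
    (\<lambda>x. \<psi> x + \<xi>1 x) \<in> dual_interval \<phi> \<and> (\<lambda>x. \<psi> x - \<xi>2 x) \<in> dual_interval \<phi>"
proof -
  have psi_pos: "\<psi> \<in> positive_dual" and diff_pos: "(\<lambda>x. \<phi> x - \<psi> x) \<in> positive_dual"
    using psi dual_interval_diff[OF phi psi] by (auto intro: dual_interval_imp_positive_dual)
  have "\<xi> \<in> dual_interval (\<lambda>x. (\<phi> x - \<psi> x) + \<psi> x)" using xi by simp
  then obtain \<xi>1 \<xi>2 where d: "\<xi>1 \<in> dual_interval (\<lambda>x. \<phi> x - \<psi> x)" "\<xi>2 \<in> dual_interval \<psi>" "\<And>x. \<xi> x = \<xi>1 x + \<xi>2 x"
    using dual_riesz_decomposition[OF diff_pos psi_pos] by metis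
  show ?thesis
  proof (intro bexI conjI allI)
    show "(\<lambda>x. \<psi> x + \<xi>1 x) \<in> dual_interval \<phi>"
      using psi d(1) by (auto simp: dual_interval_def bounded_linear_add algebra_simps)
    show "(\<lambda>x. \<psi> x - \<xi>2 x) \<in> dual_interval \<phi>"
      using dual_interval_diff[OF psi_pos d(2)] psi by (rule dual_interval_trans)
  qed (use d in \<open>auto intro: dual_interval_imp_positive_dual\<close>)
qed

text \<open>Vitali--Hahn--Saks by a gliding hump. Functionals that violate the claim are added to
  or subtracted from a running element of \<open>dual_interval \<phi>\<close>, so that a limit functional
  oscillates along \<open>u\<close>.\<close>

lemma weakly_Cauchy_equicontinuous:
  fixes u :: "nat \<Rightarrow> 'b::banach_lattice"
  assumes wc: "weakly_Cauchy u" and e: "0 \<le> e" and u_le: "\<And>n. \<bar>u n\<bar> \<le> 2 ^ n *\<^sub>R e"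
    and phi: "\<phi> \<in> positive_dual" and eps: "\<epsilon> > 0"
  shows "\<exists>\<delta>>0. \<forall>\<xi>\<in>dual_interval \<phi>. \<xi> e < \<delta> \<longrightarrow> (\<forall>n. \<bar>\<xi> (u n)\<bar> \<le> \<epsilon>)"
proof (rule ccontr)
  assume neg: "\<not> ?thesis"
  have step: "\<exists>\<psi>' n. \<psi>' \<in> dual_interval \<phi> \<and> N < n \<and> (\<forall>y r. \<bar>y\<bar> \<le> r *\<^sub>R e \<longrightarrow> 0 \<le> r \<longrightarrow> \<bar>\<psi>' y - \<psi> y\<bar> \<le> r * \<eta>) \<and>
      \<epsilon> / 8 < \<bar>\<psi>' (u n) - \<psi>' (u N)\<bar>"
    if psi: "\<psi> \<in> dual_interval \<phi>" and eta: "\<eta> > 0" for \<psi> \<eta> and N :: nat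
  proof -
    \<comment> \<open>The second entry makes \<open>\<xi>\<close> at most
      \<open>\<epsilon> / 2\<close> on \<open>u j\<close> for all \<open>j \<le> N\<close>, so the
      index violating the claim lies beyond \<open>N\<close>.\<close>
    define \<delta> where "\<delta> = min \<eta> (\<epsilon> / (2 * 2 ^ N))"
    have "\<delta> > 0" using eta eps by (simp add: \<delta>_def)
    with neg obtain \<xi> n where xi: "\<xi> \<in> dual_interval \<phi>" "\<xi> e < \<delta>" "\<epsilon> < \<bar>\<xi> (u n)\<bar>"
      by (meson not_le)
    have xi_pos: "\<xi> \<in> positive_dual" using xi(1) by (rule dual_interval_imp_positive_dual)
    have small: "\<bar>\<xi> (u j)\<bar> \<le> \<epsilon> / 2" if "j \<le> N" for j
    proof -
      have "\<bar>\<xi> (u j)\<bar> \<le> 2 ^ j * \<xi> e" by (rule positive_dual_abs_le_scale[OF xi_pos u_le])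
      also have "\<dots> \<le> 2 ^ N * \<xi> e"
        using that positive_dual_nonneg[OF xi_pos e] by (intro mult_right_mono power_increasing) auto
      also have "\<dots> \<le> 2 ^ N * (\<epsilon> / (2 * 2 ^ N))"
        using xi(2) by (intro mult_left_mono) (auto simp: \<delta>_def)
      finally show ?thesis by simp
    qed
    have "N < n" using small[of n] xi(3) eps by (cases "n \<le> N") auto
    obtain \<xi>1 \<xi>2 where d: "\<xi>1 \<in> positive_dual" "\<xi>2 \<in> positive_dual" "\<And>x. \<xi> x = \<xi>1 x + \<xi>2 x"
      "(\<lambda>x. \<psi> x + \<xi>1 x) \<in> dual_interval \<phi>" "(\<lambda>x. \<psi> x - \<xi>2 x) \<in> dual_interval \<phi>"
      using dual_interval_shift[OF phi psi xi(1)] by blast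
    have near: "\<bar>\<xi>1 y\<bar> \<le> r * \<eta>" "\<bar>\<xi>2 y\<bar> \<le> r * \<eta>" if y: "\<bar>y\<bar> \<le> r *\<^sub>R e" "0 \<le> r" for y r
    proof -
      have le: "\<xi>1 e \<le> \<eta>" "\<xi>2 e \<le> \<eta>"
        using xi(2) d(3)[of e] positive_dual_nonneg[OF d(1) e] positive_dual_nonneg[OF d(2) e]
        by (auto simp: \<delta>_def)
      show "\<bar>\<xi>1 y\<bar> \<le> r * \<eta>"
        using positive_dual_abs_le_scale[OF d(1) y(1)] mult_left_mono[OF le(1) y(2)] by linarith
      show "\<bar>\<xi>2 y\<bar> \<le> r * \<eta>"
        using positive_dual_abs_le_scale[OF d(2) y(1)] mult_left_mono[OF le(2) y(2)] by linarith
    qed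
    let ?D = "\<lambda>f. f (u n) - f (u N) :: real"
    \<comment> \<open>\<open>\<xi>\<close> is the difference of \<open>\<psi> + \<xi>1\<close> and
      \<open>\<psi> - \<xi>2\<close>, so these two cannot both have an oscillation of at most
      \<open>\<epsilon> / 8\<close>.\<close>
    have "\<epsilon> / 2 < \<bar>?D \<xi>\<bar>" using small[of N] xi(3) by linarith
    then consider "\<epsilon> / 8 < \<bar>?D \<psi>\<bar>" | "\<epsilon> / 8 < \<bar>?D (\<lambda>x. \<psi> x + \<xi>1 x)\<bar>" | "\<epsilon> / 8 < \<bar>?D (\<lambda>x. \<psi> x - \<xi>2 x)\<bar>"
      unfolding d(3) by argo
    then show ?thesis
    proof cases
      case 1
      with psi \<open>N < n\<close> eta show ?thesis by (intro exI[of _ \<psi>] exI[of _ n]) simp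
    next
      case 2
      with d(4) \<open>N < n\<close> near show ?thesis by (intro exI[of _ "\<lambda>x. \<psi> x + \<xi>1 x"] exI[of _ n]) simp
    next
      case 3
      with d(5) \<open>N < n\<close> near show ?thesis by (intro exI[of _ "\<lambda>x. \<psi> x - \<xi>2 x"] exI[of _ n]) simp
    qed
  qed
  \<comment> \<open>The factor \<open>(1/2) ^ N\<close> offsets the bound
    \<open>2 ^ N *\<^sub>R e\<close> on the vectors to be controlled, and \<open>(1/2) ^ k\<close>
    makes all later changes sum to at most \<open>\<epsilon> / 32\<close>.\<close>
  define \<eta> where "\<eta> k N = \<epsilon> / 64 * (1/2) ^ k * (1/2) ^ N" for k N :: nat
  \<comment> \<open>A state consists of the running functional and the index of \<open>u\<close>
    reached so far.\<close>
  define Q where "Q k s s' \<longleftrightarrow> snd s < snd s' \<and>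
      (\<forall>y r. \<bar>y\<bar> \<le> r *\<^sub>R e \<longrightarrow> 0 \<le> r \<longrightarrow> \<bar>fst s' y - fst s y\<bar> \<le> r * \<eta> k (snd s)) \<and>
      \<epsilon> / 8 < \<bar>fst s' (u (snd s')) - fst s' (u (snd s))\<bar>" for k and s s' :: "('b \<Rightarrow> real) \<times> nat"
  have "\<exists>s. \<forall>k. fst (s k) \<in> dual_interval \<phi> \<and> Q k (s k) (s (Suc k))"
  proof (rule dependent_nat_choice)
    show "\<exists>x :: ('b \<Rightarrow> real) \<times> nat. fst x \<in> dual_interval \<phi>"
      using self_in_dual_interval[OF phi] by (intro exI[of _ "(\<phi>, 0)"]) simp
    show "\<exists>y. fst y \<in> dual_interval \<phi> \<and> Q k x y" if x: "fst x \<in> dual_interval \<phi>" for x and k :: nat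
    proof -
      have "\<eta> k (snd x) > 0" using eps by (simp add: \<eta>_def)
      from step[OF x this] obtain \<psi>' n where "\<psi>' \<in> dual_interval \<phi>" "Q k x (\<psi>', n)"
        unfolding Q_def by fastforce
      then show ?thesis by (intro exI[of _ "(\<psi>', n)"]) simp
    qed
  qed
  then obtain s where s: "\<And>k. fst (s k) \<in> dual_interval \<phi>" "\<And>k. Q k (s k) (s (Suc k))" by metis
  define \<psi> where "\<psi> k = fst (s k)" for k
  define N where "N k = snd (s k)" for k
  have psi: "\<psi> k \<in> dual_interval \<phi>" for k using s(1) by (simp add: \<psi>_def)
  have N_mono: "strict_mono N"
    using s(2) by (intro strict_monoI_Suc) (simp add: Q_def N_def)
  have near: "\<bar>\<psi> (Suc k) y - \<psi> k y\<bar> \<le> r * \<eta> k (N k)" if "\<bar>y\<bar> \<le> r *\<^sub>R e" "0 \<le> r" for k y r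
    using s(2)[of k] that by (simp add: Q_def \<psi>_def N_def)
  have jump: "\<epsilon> / 8 < \<bar>\<psi> (Suc k) (u (N (Suc k))) - \<psi> (Suc k) (u (N k))\<bar>" for k
    using s(2)[of k] by (simp add: Q_def \<psi>_def N_def)
  have close: "\<bar>\<psi> j y - \<psi> k y\<bar> \<le> \<epsilon> / 32 * (1 - (1/2) ^ j)"
    if "k \<le> j" and y: "\<bar>y\<bar> \<le> 2 ^ N k *\<^sub>R e" for j k y
    using \<open>k \<le> j\<close>
  proof (induction j rule: dec_induct)
    case base
    show ?case using eps by (simp add: power_le_one)
  next
    case (step j)
    have "N k \<le> N j" using N_mono step.hyps(1) by (simp add: strict_mono_less_eq)
    then have "(2::real) ^ N k * (1/2) ^ N j \<le> 2 ^ N j * (1/2) ^ N j"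
      by (intro mult_right_mono power_increasing) auto
    also have "\<dots> = 1" by (simp flip: power_mult_distrib)
    finally have le1: "(2::real) ^ N k * (1/2) ^ N j \<le> 1" .
    have "\<bar>\<psi> (Suc j) y - \<psi> j y\<bar> \<le> 2 ^ N k * \<eta> j (N j)" by (rule near[OF y]) simp
    also have "\<dots> = \<epsilon> / 64 * (1/2) ^ j * (2 ^ N k * (1/2) ^ N j)" by (simp add: \<eta>_def)
    also have "\<dots> \<le> \<epsilon> / 64 * (1/2) ^ j * 1" using eps le1 by (intro mult_left_mono) auto
    finally have "\<bar>\<psi> (Suc j) y - \<psi> j y\<bar> \<le> \<epsilon> / 64 * (1/2) ^ j" by simp
    then have "\<bar>\<psi> (Suc j) y - \<psi> k y\<bar> \<le> \<epsilon> / 64 * (1/2) ^ j + \<epsilon> / 32 * (1 - (1/2) ^ j)"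
      using step.IH by linarith
    also have "\<dots> = \<epsilon> / 32 * (1 - (1/2) ^ Suc j)" by (simp add: field_simps)
    finally show ?case .
  qed
  obtain f where f: "f \<in> dual_interval \<phi>"
    "\<And>a b. \<forall>\<^sub>F j in sequentially. b \<le> \<psi> j a \<Longrightarrow> b \<le> f a"
    "\<And>a b. \<forall>\<^sub>F j in sequentially. \<psi> j a \<le> b \<Longrightarrow> f a \<le> b"
    using dual_interval_cluster[OF phi, of \<psi>] psi by metis
  have f_close: "\<bar>f y - \<psi> k y\<bar> \<le> \<epsilon> / 32" if y: "\<bar>y\<bar> \<le> 2 ^ N k *\<^sub>R e" for k y
  proof -
    have c: "\<bar>\<psi> j y - \<psi> k y\<bar> \<le> \<epsilon> / 32" if "k \<le> j" for j
    proof -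
      have "\<epsilon> / 32 * (1 - (1/2) ^ j) \<le> \<epsilon> / 32 * 1" using eps by (intro mult_left_mono) auto
      with close[OF that y] show ?thesis by linarith
    qed
    have "\<psi> k y - \<epsilon> / 32 \<le> f y"
      using c by (intro f(2) eventually_sequentiallyI[of k]) (smt (verit))
    moreover have "f y \<le> \<psi> k y + \<epsilon> / 32"
      using c by (intro f(3) eventually_sequentiallyI[of k]) (smt (verit))
    ultimately show ?thesis by linarith
  qed
  \<comment> \<open>Passing to the limit changes each of the two values by at most
    \<open>\<epsilon> / 32\<close>, which leaves \<open>\<epsilon> / 16\<close> of the jump
    \<open>\<epsilon> / 8\<close>.\<close>
  have f_jump: "\<epsilon> / 16 < \<bar>f (u (N (Suc k))) - f (u (N k))\<bar>" for k
  proof -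
    have "N k \<le> N (Suc k)" using N_mono by (simp add: strict_mono_less_eq)
    then have "(2::real) ^ N k *\<^sub>R e \<le> 2 ^ N (Suc k) *\<^sub>R e"
      using e by (intro scaleR_right_mono power_increasing) auto
    then have "\<bar>u (N k)\<bar> \<le> 2 ^ N (Suc k) *\<^sub>R e" using u_le order_trans by blast
    with f_close[of "u (N k)" "Suc k"] f_close[OF u_le, of "Suc k"] jump[of k]
    show ?thesis by linarith
  qed
  have "Cauchy (\<lambda>n. f (u n))"
    using wc f(1) by (simp add: weakly_Cauchy_def dual_interval_def)
  moreover have "\<epsilon> / 16 > 0" using eps by simp
  ultimately obtain M where M: "\<And>m n. m \<ge> M \<Longrightarrow> n \<ge> M \<Longrightarrow> \<bar>f (u m) - f (u n)\<bar> < \<epsilon> / 16"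
    unfolding Cauchy_def dist_real_def by blast
  have "N (Suc M) \<ge> M" "N M \<ge> M"
    using strict_mono_imp_increasing[OF N_mono, of M] strict_mono_imp_increasing[OF N_mono, of "Suc M"] by auto
  then have "\<bar>f (u (N (Suc M))) - f (u (N M))\<bar> < \<epsilon> / 16" by (rule M)
  with f_jump[of M] show False by simp
qed

text \<open>\<open>e\<close> is the sum of \<open>(1/2) ^ n *\<^sub>R \<bar>u n\<bar>\<close>. The
  sequence may have no order bound, but this \<open>e\<close> controls each term up to a constant,
  so that \<open>\<xi> e\<close> measures a positive functional \<open>\<xi>\<close> on all terms at
  once.\<close>

lemma dominating_element:
  fixes u :: "nat \<Rightarrow> 'b::banach_lattice"
  assumes "\<And>n. norm (u n) \<le> M"
  shows "\<exists>e\<ge>0. \<forall>n. \<bar>u n\<bar> \<le> 2 ^ n *\<^sub>R e"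
proof -
  let ?t = "\<lambda>n. (1/2) ^ n *\<^sub>R \<bar>u n\<bar>"
  have "summable ?t"
  proof (rule summable_comparison_test')
    show "summable (\<lambda>n. (1/2) ^ n * M)" by (intro summable_mult2 summable_geometric) auto
    show "norm (?t n) \<le> (1/2) ^ n * M" if "n \<ge> 0" for n
      using assms[of n] by (simp add: mult_left_mono)
  qed
  then have lim: "(\<lambda>m. \<Sum>n<m. ?t n) \<longlonglongrightarrow> suminf ?t" by (rule summable_LIMSEQ)
  have t_nonneg: "0 \<le> ?t n" for n by (intro scaleR_nonneg_nonneg) auto
  have "0 \<le> suminf ?t"
    using lim by (rule lattice_LIMSEQ_le_const) (intro sum_nonneg t_nonneg)
  moreover have "\<bar>u n\<bar> \<le> 2 ^ n *\<^sub>R suminf ?t" for n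
  proof -
    have "?t n \<le> suminf ?t"
    proof (rule lattice_LIMSEQ_le_const[OF lim, of "Suc n"])
      fix m assume "Suc n \<le> m"
      then show "?t n \<le> (\<Sum>n<m. ?t n)"
        using sum_mono2[of "{..<m}" "{n}" ?t] t_nonneg by simp
    qed
    then have "2 ^ n *\<^sub>R ?t n \<le> 2 ^ n *\<^sub>R suminf ?t" by (intro scaleR_left_mono) auto
    then show ?thesis by (simp add: power_one_over)
  qed
  ultimately show ?thesis by blast
qed

text \<open>The two bounds say that \<open>G\<close> represents the positive part of the functional \<open>F\<close>
  on the dual space.\<close>

lemma kb_space_weak_limit_positive_part:
  fixes u :: "nat \<Rightarrow> 'b::banach_lattice"
  assumes kb: "kb_space TYPE('b)" and wc: "weakly_Cauchy u"
  defines "F \<equiv> \<lambda>\<psi>. lim (\<lambda>n. \<psi> (u n))"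
  shows "\<exists>G. \<forall>\<xi>\<in>positive_dual. (\<forall>\<psi>\<in>dual_interval \<xi>. F \<psi> \<le> \<xi> G) \<and>
    (\<forall>c. (\<forall>\<psi>\<in>dual_interval \<xi>. F \<psi> \<le> c) \<longrightarrow> \<xi> G \<le> c)"
proof -
  obtain M where M: "\<And>n. norm (u n) \<le> M" using weakly_Cauchy_bounded[OF wc] by blast
  obtain e where e: "0 \<le> e" "\<And>n. \<bar>u n\<bar> \<le> 2 ^ n *\<^sub>R e" using dominating_element[of u, OF M] by blast
  have F_lim: "(\<lambda>n. \<psi> (u n)) \<longlonglongrightarrow> F \<psi>" if "\<psi> \<in> positive_dual" for \<psi>
  proof -
    have "convergent (\<lambda>n. \<psi> (u n))"
      using wc that by (simp add: weakly_Cauchy_def positive_dual_def Cauchy_convergent_iff)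
    then show ?thesis by (simp add: F_def convergent_LIMSEQ_iff)
  qed
  have F_add: "F (\<lambda>x. \<psi> x + \<omega> x) = F \<psi> + F \<omega>" if "\<psi> \<in> positive_dual" "\<omega> \<in> positive_dual" for \<psi> \<omega>
    using F_lim[OF positive_dual_add[OF that]] tendsto_add[OF F_lim[OF that(1)] F_lim[OF that(2)]]
    by (rule LIMSEQ_unique)
  have F_le: "F \<psi> \<le> c" if "\<psi> \<in> positive_dual" "\<And>n. \<psi> (u n) \<le> c" for \<psi> c
    using LIMSEQ_le_const2[OF F_lim[OF that(1)]] that(2) by blast
  have pos: "\<psi> \<in> positive_dual" if "\<psi> \<in> dual_interval \<xi>" for \<psi> \<xi> :: "'b \<Rightarrow> real"
    using that by (rule dual_interval_imp_positive_dual)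
  have psi_u_le: "\<psi> (u n) \<le> \<xi> \<bar>u n\<bar>" if "\<psi> \<in> dual_interval \<xi>" for \<psi> \<xi> n
  proof -
    have "\<psi> (u n) \<le> \<psi> \<bar>u n\<bar>" using pos[OF that] abs_ge_self by (rule positive_dual_mono)
    also have "\<dots> \<le> \<xi> \<bar>u n\<bar>" using that by (simp add: dual_interval_def)
    finally show ?thesis .
  qed
  \<comment> \<open>The Riesz--Kantorovich formula one level up, with order intervals of the dual in
    place of those of \<open>'b\<close>. Riesz decomposition in the dual makes \<open>Fp\<close>
    additive.\<close>
  define Fp where "Fp \<xi> = (SUP \<psi>\<in>dual_interval \<xi>. F \<psi>)" for \<xi>
  have bdd: "bdd_above (F ` dual_interval \<xi>)" if xi: "\<xi> \<in> positive_dual" for \<xi>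
  proof -
    have bl: "bounded_linear \<xi>" using xi by (simp add: positive_dual_def)
    obtain B where B: "B > 0" "\<And>x. norm (\<xi> x) \<le> norm x * B"
      using bounded_linear.pos_bounded[OF bl] by blast
    have "F \<psi> \<le> M * B" if psi: "\<psi> \<in> dual_interval \<xi>" for \<psi>
    proof (rule F_le[OF pos[OF psi]])
      fix n
      have "\<psi> (u n) \<le> norm (u n) * B" using psi_u_le[OF psi, of n] B(2)[of "\<bar>u n\<bar>"] by simp
      also have "\<dots> \<le> M * B" using M B(1) by (intro mult_right_mono) auto
      finally show "\<psi> (u n) \<le> M * B" .
    qed
    then show ?thesis by (intro bdd_aboveI2)
  qed
  have Fp_upper: "F \<psi> \<le> Fp \<xi>" if "\<xi> \<in> positive_dual" "\<psi> \<in> dual_interval \<xi>" for \<xi> \<psi>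
    unfolding Fp_def using that by (intro cSUP_upper bdd)
  have Fp_least: "Fp \<xi> \<le> c" if "\<xi> \<in> positive_dual" "\<And>\<psi>. \<psi> \<in> dual_interval \<xi> \<Longrightarrow> F \<psi> \<le> c" for \<xi> c
    unfolding Fp_def using that self_in_dual_interval by (intro cSUP_least) auto
  have Fp_add: "Fp (\<lambda>x. \<xi> x + \<omega> x) = Fp \<xi> + Fp \<omega>"
    if xi: "\<xi> \<in> positive_dual" and omega: "\<omega> \<in> positive_dual" for \<xi> \<omega>
  proof (rule antisym)
    note sum_pos = positive_dual_add[OF xi omega]
    show "Fp (\<lambda>x. \<xi> x + \<omega> x) \<le> Fp \<xi> + Fp \<omega>"
    proof (rule Fp_least[OF sum_pos])
      fix \<psi> assume "\<psi> \<in> dual_interval (\<lambda>x. \<xi> x + \<omega> x)"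
      then obtain \<psi>1 \<psi>2 where d: "\<psi>1 \<in> dual_interval \<xi>" "\<psi>2 \<in> dual_interval \<omega>" "\<And>x. \<psi> x = \<psi>1 x + \<psi>2 x"
        using dual_riesz_decomposition[OF xi omega] by metis
      then have "\<psi> = (\<lambda>x. \<psi>1 x + \<psi>2 x)" by auto
      then have "F \<psi> = F \<psi>1 + F \<psi>2" using F_add pos d(1,2) by simp
      then show "F \<psi> \<le> Fp \<xi> + Fp \<omega>"
        using Fp_upper[OF xi d(1)] Fp_upper[OF omega d(2)] by simp
    qed
    have "F \<psi>1 + F \<psi>2 \<le> Fp (\<lambda>x. \<xi> x + \<omega> x)" if "\<psi>1 \<in> dual_interval \<xi>" "\<psi>2 \<in> dual_interval \<omega>" for \<psi>1 \<psi>2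
    proof -
      have "(\<lambda>x. \<psi>1 x + \<psi>2 x) \<in> dual_interval (\<lambda>x. \<xi> x + \<omega> x)"
        using that by (auto simp: dual_interval_def bounded_linear_add add_mono)
      from Fp_upper[OF sum_pos this] show ?thesis
        using F_add[OF pos[OF that(1)] pos[OF that(2)]] by simp
    qed
    then have "F \<psi>1 \<le> Fp (\<lambda>x. \<xi> x + \<omega> x) - F \<psi>2" if "\<psi>1 \<in> dual_interval \<xi>" "\<psi>2 \<in> dual_interval \<omega>" for \<psi>1 \<psi>2
      using that by (simp add: le_diff_eq)
    then have "Fp \<xi> \<le> Fp (\<lambda>x. \<xi> x + \<omega> x) - F \<psi>2" if "\<psi>2 \<in> dual_interval \<omega>" for \<psi>2
      using that xi by (intro Fp_least)
    then have "F \<psi>2 \<le> Fp (\<lambda>x. \<xi> x + \<omega> x) - Fp \<xi>" if "\<psi>2 \<in> dual_interval \<omega>" for \<psi>2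
      using that by (simp add: le_diff_eq add.commute)
    then have "Fp \<omega> \<le> Fp (\<lambda>x. \<xi> x + \<omega> x) - Fp \<xi>" using omega by (intro Fp_least)
    then show "Fp \<xi> + Fp \<omega> \<le> Fp (\<lambda>x. \<xi> x + \<omega> x)" by simp
  qed
  have F_zero: "F (\<lambda>_. 0) = 0" by (simp add: F_def)
  have Fp_nonneg: "0 \<le> Fp \<xi>" if "\<xi> \<in> positive_dual" for \<xi>
    using Fp_upper[OF that zero_in_dual_interval[OF that]] F_zero by simp
  define S where "S = {x. 0 \<le> x \<and> (\<forall>\<xi>\<in>positive_dual. \<xi> x \<le> Fp \<xi>)}"
  have "0 \<in> S" using Fp_nonneg by (auto simp: S_def linear_0[OF positive_dual_linear])
  moreover have "sup x y \<in> S" if "x \<in> S" "y \<in> S" for x y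
  proof -
    have "\<xi> (sup x y) \<le> Fp \<xi>" if xi: "\<xi> \<in> positive_dual" for \<xi>
    proof -
      obtain \<xi>1 \<xi>2 where d: "\<xi>1 \<in> positive_dual" "\<xi>2 \<in> positive_dual" "\<And>z. \<xi> z = \<xi>1 z + \<xi>2 z"
        "\<xi> (sup x y) = \<xi>1 x + \<xi>2 y"
        using positive_dual_sup[OF xi] by metis
      have "\<xi> (sup x y) \<le> Fp \<xi>1 + Fp \<xi>2"
        using d \<open>x \<in> S\<close> \<open>y \<in> S\<close> by (auto simp: S_def intro: add_mono)
      also have "\<dots> = Fp (\<lambda>z. \<xi>1 z + \<xi>2 z)" using d by (simp add: Fp_add)
      also have "(\<lambda>z. \<xi>1 z + \<xi>2 z) = \<xi>" using d(3) by auto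
      finally show ?thesis .
    qed
    then show ?thesis using that by (auto simp: S_def intro: le_supI1)
  qed
  moreover have "norm x \<le> M" if x: "x \<in> S" for x
  proof -
    obtain \<xi> where xi: "\<xi> \<in> positive_dual" "\<xi> x = norm (pprt x)" "\<And>y. \<xi> y \<le> norm y"
      using positive_dual_norm_pprt by blast
    have "norm x = \<xi> x" using x xi(2) by (simp add: S_def)
    also have "\<dots> \<le> Fp \<xi>" using x xi(1) by (simp add: S_def)
    also have "\<dots> \<le> M"
    proof (rule Fp_least[OF xi(1)])
      fix \<psi> assume psi: "\<psi> \<in> dual_interval \<xi>"
      have "\<psi> (u n) \<le> M" for n
        using psi_u_le[OF psi, of n] xi(3)[of "\<bar>u n\<bar>"] M[of n] by simp
      then show "F \<psi> \<le> M" using pos[OF psi] by (intro F_le)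
    qed
    finally show ?thesis .
  qed
  ultimately obtain G v where G: "\<And>x. x \<in> S \<Longrightarrow> x \<le> G" "\<And>n. v n \<in> S" "v \<longlonglongrightarrow> G"
    using kb_space_directed_sup[OF kb, of S M] by blast
  have "0 \<le> G" using G(1) \<open>0 \<in> S\<close> by blast
  have G_le: "\<xi> G \<le> Fp \<xi>" if "\<xi> \<in> positive_dual" for \<xi>
    using positive_dual_tendsto[OF that G(3)] G(2) that
    by (intro LIMSEQ_le_const2) (auto simp: S_def)
  define H where "H \<xi> = Fp \<xi> - \<xi> G" for \<xi>
  have H_nonneg: "0 \<le> H \<xi>" if "\<xi> \<in> positive_dual" for \<xi>
    using G_le[OF that] by (simp add: H_def)
  have H_add: "H (\<lambda>x. \<xi> x + \<omega> x) = H \<xi> + H \<omega>" if "\<xi> \<in> positive_dual" "\<omega> \<in> positive_dual" for \<xi> \<omega>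
    using Fp_add[OF that] by (simp add: H_def)
  have H_mono: "H \<psi> \<le> H \<xi>" if xi: "\<xi> \<in> positive_dual" and psi: "\<psi> \<in> dual_interval \<xi>" for \<xi> \<psi>
    using H_add[OF pos[OF dual_interval_diff[OF xi psi]] pos[OF psi]]
      H_nonneg[OF pos[OF dual_interval_diff[OF xi psi]]] by simp
  have H_zero: "H \<phi> = 0" if phi: "\<phi> \<in> positive_dual" for \<phi>
  proof (rule ccontr)
    assume "H \<phi> \<noteq> 0"
    then have H_phi: "H \<phi> > 0" using H_nonneg[OF phi] by simp
    have phi_e: "0 \<le> \<phi> e" using phi e(1) by (rule positive_dual_nonneg)
    \<comment> \<open>Everything in the interval below \<open>\<xi>\<close> is as small at
      \<open>e\<close> as \<open>\<xi>\<close>, so the equicontinuity bound holds for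
      \<open>Fp \<xi>\<close>, and \<open>H \<xi> \<le> Fp \<xi>\<close> because
      \<open>0 \<le> G\<close>.\<close>
    have H_cont: "\<exists>\<delta>>0. \<forall>\<xi>\<in>dual_interval \<phi>. \<xi> e < \<delta> \<longrightarrow> H \<xi> \<le> \<epsilon>" if eps: "\<epsilon> > 0" for \<epsilon>
    proof -
      obtain \<delta> where delta: "\<delta> > 0" "\<And>\<xi> n. \<xi> \<in> dual_interval \<phi> \<Longrightarrow> \<xi> e < \<delta> \<Longrightarrow> \<bar>\<xi> (u n)\<bar> \<le> \<epsilon>"
        using weakly_Cauchy_equicontinuous[OF wc e phi eps] by blast
      have "H \<xi> \<le> \<epsilon>" if xi: "\<xi> \<in> dual_interval \<phi>" "\<xi> e < \<delta>" for \<xi>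
      proof -
        have "Fp \<xi> \<le> \<epsilon>"
        proof (rule Fp_least[OF pos[OF xi(1)]])
          fix \<psi> assume psi: "\<psi> \<in> dual_interval \<xi>"
          have "\<psi> e \<le> \<xi> e" using psi e(1) by (simp add: dual_interval_def)
          then have "\<bar>\<psi> (u n)\<bar> \<le> \<epsilon>" for n
            using xi(2) dual_interval_trans[OF psi xi(1)] by (intro delta(2)) auto
          then have "\<psi> (u n) \<le> \<epsilon>" for n using abs_le_D1 by blast
          then show "F \<psi> \<le> \<epsilon>" using pos[OF psi] by (intro F_le)
        qed
        then show ?thesis
          using positive_dual_nonneg[OF pos[OF xi(1)] \<open>0 \<le> G\<close>] by (simp add: H_def)
      qed
      with delta(1) show ?thesis by blast
    qed
    \<comment> \<open>This keeps \<open>l * \<phi> e\<close> at or below half of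
      \<open>H \<phi>\<close>, so that \<open>T \<phi>\<close> is positive; the summand
      \<open>1\<close> guards against \<open>\<phi> e = 0\<close>.\<close>
    define l where "l = H \<phi> / (2 * (\<phi> e + 1))"
    have l: "l > 0" using H_phi phi_e by (simp add: l_def)
    define T where "T \<xi> = H \<xi> - l * \<xi> e" for \<xi>
    have T_add: "T (\<lambda>x. \<xi> x + \<omega> x) = T \<xi> + T \<omega>" if "\<xi> \<in> positive_dual" "\<omega> \<in> positive_dual" for \<xi> \<omega>
      using H_add[OF that] by (simp add: T_def algebra_simps)
    have T_cont: "\<exists>\<delta>>0. \<forall>\<xi>\<in>dual_interval \<phi>. \<xi> e < \<delta> \<longrightarrow> \<bar>T \<xi>\<bar> \<le> \<epsilon>" if eps: "\<epsilon> > 0" for \<epsilon>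
    proof -
      obtain \<delta> where delta: "\<delta> > 0" "\<And>\<xi>. \<xi> \<in> dual_interval \<phi> \<Longrightarrow> \<xi> e < \<delta> \<Longrightarrow> H \<xi> \<le> \<epsilon>"
        using H_cont[OF eps] by blast
      have "\<bar>T \<xi>\<bar> \<le> \<epsilon>" if xi: "\<xi> \<in> dual_interval \<phi>" "\<xi> e < min \<delta> (\<epsilon> / l)" for \<xi>
      proof -
        have "0 \<le> l * \<xi> e" "l * \<xi> e \<le> \<epsilon>"
          using xi(2) l positive_dual_nonneg[OF pos[OF xi(1)] e(1)] by (auto simp: field_simps)
        with delta(2)[OF xi(1)] H_nonneg[OF pos[OF xi(1)]] xi(2) show ?thesis by (simp add: T_def)
      qed
      then show ?thesis using delta(1) eps l by (intro exI[of _ "min \<delta> (\<epsilon> / l)"]) simp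
    qed
    have T_lower: "- (l * \<phi> e) \<le> T \<xi>" if "\<xi> \<in> dual_interval \<phi>" for \<xi>
    proof -
      have "l * \<xi> e \<le> l * \<phi> e" using that e(1) l by (intro mult_left_mono) (auto simp: dual_interval_def)
      then show ?thesis using H_nonneg[OF pos[OF that]] by (simp add: T_def)
    qed
    \<comment> \<open>On the interval below \<open>\<phi>'\<close>, \<open>H\<close> dominates
      \<open>l\<close> times evaluation at \<open>e\<close>. This is what ties \<open>H\<close> to
      an element of \<open>'b\<close>.\<close>
    obtain \<phi>' where phi': "\<phi>' \<in> dual_interval \<phi>" "T \<phi> \<le> T \<phi>'" "\<And>\<xi>. \<xi> \<in> dual_interval \<phi>' \<Longrightarrow> 0 \<le> T \<xi>"
      using dual_hahn_decomposition[where T = T, OF phi e(1) T_add T_cont T_lower] by blast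
    have phi'_pos: "\<phi>' \<in> positive_dual" using phi'(1) by (rule pos)
    have "l * \<phi> e \<le> H \<phi> / 2"
    proof -
      have "l * \<phi> e \<le> l * (\<phi> e + 1)" using l by simp
      also have "\<dots> = H \<phi> / 2" using phi_e by (simp add: l_def field_simps)
      finally show ?thesis .
    qed
    then have T_phi': "0 < T \<phi>'" using phi'(2) H_phi by (simp add: T_def)
    have "0 < \<phi>' e"
    proof (rule ccontr)
      assume "\<not> 0 < \<phi>' e"
      then have "\<phi>' e = 0" using positive_dual_nonneg[OF phi'_pos e(1)] by simp
      then have "H \<phi>' \<le> 0 + \<epsilon>" if "\<epsilon> > 0" for \<epsilon> using H_cont[OF that] phi'(1) by auto
      then have "H \<phi>' \<le> 0" by (rule field_le_epsilon)
      then show False using T_phi' \<open>\<phi>' e = 0\<close> by (simp add: T_def)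
    qed
    then obtain x where x: "0 \<le> x" "x \<le> e" "x \<noteq> 0" "\<And>a. 0 \<le> a \<Longrightarrow> a \<le> x \<Longrightarrow> \<phi>' a = 0 \<Longrightarrow> a = 0"
      using kb_space_carrier[OF kb phi'_pos e(1)] by metis
    have T_multiple: "0 \<le> T \<psi>" if psi: "\<psi> \<in> dual_interval (\<lambda>y. real n * \<phi>' y)" for \<psi> n
    proof -
      \<comment> \<open>Dividing by \<open>Suc n\<close> brings \<open>\<psi>\<close> below
        \<open>\<phi>'\<close> and also covers \<open>n = 0\<close>.\<close>
      define \<omega> where "\<omega> y = inverse (real (Suc n)) * \<psi> y" for y
      have "\<psi> y \<le> real (Suc n) * \<phi>' y" if "0 \<le> y" for y
      proof -
        have "\<psi> y \<le> real n * \<phi>' y" using psi that by (simp add: dual_interval_def)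
        then show ?thesis using positive_dual_nonneg[OF phi'_pos that] by (simp add: algebra_simps)
      qed
      moreover have "bounded_linear \<omega>"
        using psi unfolding \<omega>_def[abs_def] dual_interval_def by (intro bounded_linear_const_mult) simp
      ultimately have omega: "\<omega> \<in> dual_interval \<phi>'"
        using psi by (auto simp: dual_interval_def \<omega>_def field_simps simp del: of_nat_Suc)
      have T_scale: "T (\<lambda>y. real k * \<omega> y) = real k * T \<omega>" for k
      proof (induction k)
        case 0
        show ?case using T_add[of "\<lambda>_. 0" "\<lambda>_. 0"] by (simp add: positive_dual_def)
      next
        case (Suc k)
        have "T (\<lambda>y. real (Suc k) * \<omega> y) = T (\<lambda>y. real k * \<omega> y + \<omega> y)" by (simp add: algebra_simps)
        also have "\<dots> = real k * T \<omega> + T \<omega>"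
          using positive_dual_scale[OF pos[OF omega], of "real k"] pos[OF omega] by (simp add: T_add Suc)
        finally show ?case by (simp add: algebra_simps)
      qed
      have "\<psi> = (\<lambda>y. real (Suc n) * \<omega> y)" by (auto simp: \<omega>_def field_simps)
      then have "T \<psi> = real (Suc n) * T \<omega>" using T_scale by metis
      then show ?thesis using phi'(3)[OF omega] by simp
    qed
    \<comment> \<open>A truncation \<open>\<psi>\<close> of \<open>\<xi>\<close> lies below a
      multiple of \<open>\<phi>'\<close>, so
      \<open>l * \<psi> x \<le> l * \<psi> e \<le> H \<psi> \<le> H \<xi>\<close>. On the carrier
      \<open>x\<close> of \<open>\<phi>'\<close> truncating loses arbitrarily little.\<close>
    have x_le: "l * \<xi> x \<le> H \<xi>" if xi: "\<xi> \<in> positive_dual" for \<xi>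
    proof (rule field_le_epsilon)
      fix \<epsilon> :: real assume "\<epsilon> > 0"
      then have "\<epsilon> / l > 0" using l by simp
      then obtain \<psi> n where psi: "\<psi> \<in> dual_interval \<xi>" "\<psi> \<in> dual_interval (\<lambda>y. real n * \<phi>' y)" "\<xi> x \<le> \<psi> x + \<epsilon> / l"
        using kb_space_dual_truncation[OF kb phi'_pos xi x(1,4), of "\<epsilon> / l"] by blast
      have "l * \<xi> x \<le> l * (\<psi> x + \<epsilon> / l)" using psi(3) l by (intro mult_left_mono) auto
      also have "\<dots> = l * \<psi> x + \<epsilon>" using l by (simp add: field_simps)
      also have "l * \<psi> x \<le> l * \<psi> e"
        using positive_dual_mono[OF pos[OF psi(1)] x(2)] l by (intro mult_left_mono) auto
      also have "l * \<psi> e \<le> H \<psi>" using T_multiple[OF psi(2)] by (simp add: T_def)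
      also have "H \<psi> \<le> H \<xi>" using xi psi(1) by (rule H_mono)
      finally show "l * \<xi> x \<le> H \<xi> + \<epsilon>" by simp
    qed
    have "\<xi> (G + l *\<^sub>R x) \<le> Fp \<xi>" if xi: "\<xi> \<in> positive_dual" for \<xi>
      using x_le[OF xi] positive_dual_linear[OF xi] by (simp add: H_def linear_add linear_scale)
    moreover have lx: "0 \<le> l *\<^sub>R x" using l x(1) by (intro scaleR_nonneg_nonneg) auto
    ultimately have "G + l *\<^sub>R x \<in> S" using \<open>0 \<le> G\<close> by (simp add: S_def)
    then have "G + l *\<^sub>R x \<le> G" by (rule G(1))
    then have "l *\<^sub>R x = 0" using lx by simp
    then show False using l x(3) by simp
  qed
  then have "\<xi> G = Fp \<xi>" if "\<xi> \<in> positive_dual" for \<xi> using that by (simp add: H_def)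
  then show ?thesis using Fp_upper Fp_least by (intro exI[of _ G]) simp
qed

lemma kb_space_imp_weakly_sequentially_complete:
  assumes kb: "kb_space TYPE('b::banach_lattice)"
  shows "weakly_sequentially_complete TYPE('b)"
  unfolding weakly_sequentially_complete_def
proof (intro allI impI)
  fix u :: "nat \<Rightarrow> 'b" assume wc: "weakly_Cauchy u"
  have lin: "\<psi> (- x) = - \<psi> x" if "bounded_linear \<psi>" for \<psi> :: "'b \<Rightarrow> real" and x
    using that by (simp add: bounded_linear.linear linear_neg)
  have wc': "weakly_Cauchy (\<lambda>n. - u n)"
    using wc by (simp add: weakly_Cauchy_def lin Cauchy_convergent_iff convergent_minus_iff[symmetric])
  define F where "F \<psi> = lim (\<lambda>n. \<psi> (u n))" for \<psi> :: "'b \<Rightarrow> real"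
  have F_lim: "(\<lambda>n. \<psi> (u n)) \<longlonglongrightarrow> F \<psi>" if "bounded_linear \<psi>" for \<psi>
  proof -
    have "convergent (\<lambda>n. \<psi> (u n))"
      using wc that by (simp add: weakly_Cauchy_def Cauchy_convergent_iff)
    then show ?thesis by (simp add: F_def convergent_LIMSEQ_iff)
  qed
  have F_minus: "lim (\<lambda>n. \<psi> (- u n)) = - F \<psi>" if "bounded_linear \<psi>" for \<psi>
    using tendsto_minus[OF F_lim[OF that]] lin[OF that] by (intro limI) simp
  have F_diff: "F (\<lambda>x. \<xi> x - \<psi> x) = F \<xi> - F \<psi>" if "bounded_linear \<xi>" "bounded_linear \<psi>" for \<xi> \<psi>
    using F_lim[OF bounded_linear_sub[OF that]] tendsto_diff[OF F_lim[OF that(1)] F_lim[OF that(2)]]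
    by (rule LIMSEQ_unique)
  obtain G where G: "\<And>\<xi> \<psi>. \<xi> \<in> positive_dual \<Longrightarrow> \<psi> \<in> dual_interval \<xi> \<Longrightarrow> F \<psi> \<le> \<xi> G"
    "\<And>\<xi> c. \<xi> \<in> positive_dual \<Longrightarrow> (\<And>\<psi>. \<psi> \<in> dual_interval \<xi> \<Longrightarrow> F \<psi> \<le> c) \<Longrightarrow> \<xi> G \<le> c"
    using kb_space_weak_limit_positive_part[OF kb wc] unfolding F_def by metis
  obtain G' where G': "\<And>\<xi> \<psi>. \<xi> \<in> positive_dual \<Longrightarrow> \<psi> \<in> dual_interval \<xi> \<Longrightarrow> lim (\<lambda>n. \<psi> (- u n)) \<le> \<xi> G'"
    "\<And>\<xi> c. \<xi> \<in> positive_dual \<Longrightarrow> (\<And>\<psi>. \<psi> \<in> dual_interval \<xi> \<Longrightarrow> lim (\<lambda>n. \<psi> (- u n)) \<le> c) \<Longrightarrow> \<xi> G' \<le> c"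
    using kb_space_weak_limit_positive_part[OF kb wc'] by metis
  have F_eq: "F \<xi> = \<xi> (G - G')" if xi: "\<xi> \<in> positive_dual" for \<xi>
  proof -
    have bl: "bounded_linear \<psi>" if "\<psi> \<in> dual_interval \<xi>" for \<psi>
      using that by (simp add: dual_interval_def)
    \<comment> \<open>The reflection of \<open>\<psi>\<close> to \<open>\<xi> - \<psi>\<close> maps
      the interval to itself and changes \<open>F \<psi>\<close> into
      \<open>F \<xi> - F \<psi>\<close>. Hence the suprema of \<open>F\<close> and of
      \<open>- F\<close> over the interval differ by \<open>F \<xi>\<close>.\<close>
    have "\<xi> G' \<le> \<xi> G - F \<xi>"
    proof (rule G'(2)[OF xi])
      fix \<psi> assume psi: "\<psi> \<in> dual_interval \<xi>"
      show "lim (\<lambda>n. \<psi> (- u n)) \<le> \<xi> G - F \<xi>"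
        using G(1)[OF xi dual_interval_diff[OF xi psi]] F_diff[OF _ bl[OF psi], of \<xi>] F_minus[OF bl[OF psi]] xi
        by (simp add: positive_dual_def)
    qed
    moreover have "\<xi> G \<le> F \<xi> + \<xi> G'"
    proof (rule G(2)[OF xi])
      fix \<psi> assume psi: "\<psi> \<in> dual_interval \<xi>"
      note diff = dual_interval_diff[OF xi psi]
      show "F \<psi> \<le> F \<xi> + \<xi> G'"
        using G'(1)[OF xi diff] F_diff[OF _ bl[OF psi], of \<xi>] F_minus[OF bl[OF diff]] xi
        by (simp add: positive_dual_def)
    qed
    ultimately show ?thesis
      using linear_diff[OF positive_dual_linear[OF xi], of G G'] by linarith
  qed
  \<comment> \<open>The identity for positive functionals suffices: \<open>f\<close> is the
    difference of \<open>g\<close> and \<open>g - f\<close>, both positive.\<close>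
  have "(\<lambda>n. f (u n)) \<longlonglongrightarrow> f (G - G')" if f: "bounded_linear f" for f :: "'b \<Rightarrow> real"
  proof -
    obtain g where g: "g \<in> positive_dual" "\<And>x. 0 \<le> x \<Longrightarrow> f x \<le> g x"
      using dual_positive_part[OF f] by metis
    have h: "(\<lambda>x. g x - f x) \<in> positive_dual"
      using g f by (simp add: positive_dual_def bounded_linear_sub)
    have "(\<lambda>n. g (u n) - (g (u n) - f (u n))) \<longlonglongrightarrow> F g - F (\<lambda>x. g x - f x)"
      using g(1) h by (intro tendsto_diff F_lim[of g] F_lim[of "\<lambda>x. g x - f x"]) (auto simp: positive_dual_def)
    then show ?thesis using F_eq[OF g(1)] F_eq[OF h] by simp
  qed
  then show "\<exists>y. weakly_converges_to u y" unfolding weakly_converges_to_def by blast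
qed

theorem theorem5p3:
  assumes "(UNIV :: 'a::real_vector set) \<noteq> {0}"
  shows "weakly_sequentially_complete TYPE('b::banach_lattice) \<longleftrightarrow>
    (\<forall>(K :: 'b set) (f :: 'a \<Rightarrow> 'b).
       closed K \<and> convex K \<and> normal_cone K \<and> cone_convex K f \<longrightarrow>
       (\<forall>x\<^sub>0 h. h \<noteq> 0 \<longrightarrow> (\<exists>D. has_dir_deriv f x\<^sub>0 h D)))"
proof (intro iffI allI impI)
  fix K :: "'b set" and f :: "'a \<Rightarrow> 'b" and x h :: 'a
  assume "weakly_sequentially_complete TYPE('b)"
    and "closed K \<and> convex K \<and> normal_cone K \<and> cone_convex K f"
  then show "\<exists>D. has_dir_deriv f x h D"
    using has_dir_deriv_if_weakly_sequentially_complete by blast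
next
  assume deriv: "\<forall>(K :: 'b set) (f :: 'a \<Rightarrow> 'b).
       closed K \<and> convex K \<and> normal_cone K \<and> cone_convex K f \<longrightarrow>
       (\<forall>x h. h \<noteq> 0 \<longrightarrow> (\<exists>D. has_dir_deriv f x h D))"
  obtain h :: 'a where "h \<noteq> 0" using assms by auto
  then have "kb_space TYPE('b)"
    by (rule kb_space_if_dir_deriv) (use deriv \<open>h \<noteq> 0\<close> in blast)
  then show "weakly_sequentially_complete TYPE('b)"
    by (rule kb_space_imp_weakly_sequentially_complete)
qed

end
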